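(* Let $\Gamma$ be a finitely generated residually finite infinite group, $\{\Gamma_n\}_{n=1}^\infty$ a sequence of finite-index normal subgroups with $\bigcap_n\bigcup_{i\ge n}\Gamma_i=\{e\}$, and $f\in\mathbb{Z}\Gamma$ well-balanced. Let $\rho$ be a compatible metric on $X_f$. Then $\mathrm{Fix}_{\Gamma_n}(X_f)\to X_f$ in the Hausdorff distance as $n\to\infty$.
   Context: $f\in\mathbb{Z}\Gamma$ is well-balanced if $\sum_sf_s=0$, $f_s\le0$ for $s\ne e$, $f_s=f_{s^{-1}}$, and the support of $f$ generates $\Gamma$. $X_f=\{x\in(\mathbb{R}/\mathbb{Z})^\Gamma:\sum_sx_{ts}f_s=0\ \forall t\}$ with action $(sx)_t=x_{s^{-1}t}$; $\mathrm{Fix}_{\Gamma_n}(X_f)$ is the set of points fixed by all elements of $\Gamma_n$. Hausdorff distance between closed nonempty $Y,Z$: $\max(\max_{y\in Y}\min_{z\in Z}\rho(y,z),\max_{z\in Z}\min_{y\in Y}\rho(z,y))$. *)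

theory Defs
  imports "HOL-Analysis.Analysis"
begin

(* The group Gamma is written additively as a (not necessarily commutative)
   type of class group_add: e = 0, st = s + t, s^{-1} = - s. *)

definition is_subgroup :: "'g::group_add set \<Rightarrow> bool" where
  "is_subgroup H \<longleftrightarrow> 0 \<in> H \<and> (\<forall>a\<in>H. \<forall>b\<in>H. a + b \<in> H) \<and> (\<forall>a\<in>H. - a \<in> H)"

definition is_normal_subgroup :: "'g::group_add set \<Rightarrow> bool" where
  "is_normal_subgroup H \<longleftrightarrow> is_subgroup H \<and> (\<forall>g. \<forall>h\<in>H. g + h - g \<in> H)"

definition finite_index :: "'g::group_add set \<Rightarrow> bool" where
  "finite_index H \<longleftrightarrow> finite {(\<lambda>h. g + h) ` H | g. True}"

definition generated_subgroup :: "'g::group_add set \<Rightarrow> 'g set" where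
  "generated_subgroup S = \<Inter> {H. is_subgroup H \<and> S \<subseteq> H}"

definition finitely_generated :: "'g::group_add itself \<Rightarrow> bool" where
  "finitely_generated _ \<longleftrightarrow> (\<exists>S::'g set. finite S \<and> generated_subgroup S = UNIV)"

definition residually_finite :: "'g::group_add itself \<Rightarrow> bool" where
  "residually_finite _ \<longleftrightarrow>
     (\<forall>g::'g. g \<noteq> 0 \<longrightarrow> (\<exists>N. is_normal_subgroup N \<and> finite_index N \<and> g \<notin> N))"

(* elements of Z Gamma: finitely supported integer-valued functions *)
definition supp :: "('g \<Rightarrow> int) \<Rightarrow> 'g set" where
  "supp f = {s. f s \<noteq> 0}"

definition well_balanced :: "('g::group_add \<Rightarrow> int) \<Rightarrow> bool" where
  "well_balanced f \<longleftrightarrow> finite (supp f) \<and> (\<Sum>s\<in>supp f. f s) = 0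
     \<and> (\<forall>s. s \<noteq> 0 \<longrightarrow> f s \<le> 0) \<and> (\<forall>s. f s = f (- s))
     \<and> generated_subgroup (supp f) = UNIV"

(* R/Z is realised as the unit circle in C via the quotient map t \<mapsto> exp(2 pi i t);
   (R/Z)^Gamma carries the product topology (instance on function spaces). *)
definition circ :: "real \<Rightarrow> complex" where
  "circ t = cis (2 * pi * t)"

definition X_f :: "('g::group_add \<Rightarrow> int) \<Rightarrow> ('g \<Rightarrow> complex) set" where
  "X_f f = {y. \<exists>x::'g \<Rightarrow> real. y = (\<lambda>t. circ (x t)) \<and>
              (\<forall>t. (\<Sum>s\<in>supp f. x (t + s) * of_int (f s)) \<in> \<int>)}"

definition shift :: "'g::group_add \<Rightarrow> ('g \<Rightarrow> 'a) \<Rightarrow> ('g \<Rightarrow> 'a)" where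
  "shift s x = (\<lambda>t. x (- s + t))"

definition Fix :: "'g::group_add set \<Rightarrow> ('g \<Rightarrow> 'a) set \<Rightarrow> ('g \<Rightarrow> 'a) set" where
  "Fix H X = {x \<in> X. \<forall>s\<in>H. shift s x = x}"

definition hausdorff_dist :: "('a \<Rightarrow> 'a \<Rightarrow> real) \<Rightarrow> 'a set \<Rightarrow> 'a set \<Rightarrow> real" where
  "hausdorff_dist \<rho> Y Z =
     max (SUP y\<in>Y. INF z\<in>Z. \<rho> y z) (SUP z\<in>Z. INF y\<in>Y. \<rho> z y)"

end

theory Submission
  imports Defs
begin

text \<open>
  Write \<open>L x t = (\<Sum>s. x (t + s) f s)\<close>. Periodic points are images of \<open>\<Gamma>\<^sub>n\<close>-periodic real functions
  \<open>x\<close> with \<open>L x\<close> integral, and a point of \<open>X_f\<close> is approximated by \<open>Fix \<Gamma>\<^sub>n\<close> on a finite window as soon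
  as finitely many characters \<open>h\<close> (independent of \<open>n\<close>) that are trivial on \<open>Fix \<Gamma>\<^sub>n\<close> are trivial on
  \<open>X_f\<close>. If \<open>h\<close> is trivial on \<open>Fix \<Gamma>\<^sub>n\<close>, then duality in the finite quotient gives an integral
  \<open>\<Gamma>\<^sub>n\<close>-periodic potential \<open>v\<close> with \<open>L v\<close> the periodization of \<open>h\<close>. The Dirichlet energy bounds the
  oscillation of \<open>v\<close> independently of \<open>n\<close>; since \<open>v\<close> is integral and harmonic off the support of \<open>h\<close>,
  it is locally constant outside a fixed ball. A level set of \<open>v\<close> and a distant translate of it have
  disjoint boundaries and equal cardinality in the quotient, which forces \<open>v\<close> to be constant outside
  a fixed finite set. For large \<open>n\<close> this set embeds into \<open>\<Gamma>/\<Gamma>\<^sub>n\<close>, so \<open>v\<close> minus that constant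
  lifts to a finitely supported \<open>u\<close> with \<open>L u = h\<close>, and \<open>h\<close> is trivial on \<open>X_f\<close>.
\<close>

section \<open>Finite linear systems\<close>

text \<open>Gaussian elimination, by induction on the equations: an equation whose coefficients all
  vanish is dropped, any other one is used to eliminate an unknown \<open>j0\<close> with nonzero
  coefficient.\<close>

lemma underdetermined_homogeneous_system:
  fixes a :: "'i \<Rightarrow> 'j \<Rightarrow> real"
  assumes "finite I" "finite J" "card I < card J"
  shows "\<exists>x. (\<exists>j\<in>J. x j \<noteq> 0) \<and> (\<forall>i\<in>I. (\<Sum>j\<in>J. a i j * x j) = 0)"
  using assms
proof (induction I arbitrary: J a rule: finite_induct)
  case empty
  then have "J \<noteq> {}" by auto
  then show ?case by (intro exI[of _ "\<lambda>_. 1"]) auto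
next
  case (insert i0 I)
  show ?case
  proof (cases "\<forall>j\<in>J. a i0 j = 0")
    case True
    have "card I < card J" using insert by simp
    from insert.IH[OF insert.prems(1) this, of a] True show ?thesis by auto
  next
    case False
    then obtain j0 where j0: "j0 \<in> J" "a i0 j0 \<noteq> 0" by blast
    define J' where "J' = J - {j0}"
    have J': "finite J'" "card I < card J'" "J = insert j0 J'" "j0 \<notin> J'"
      using insert j0 by (auto simp: J'_def)
    define b where "b i j = a i j - a i j0 * a i0 j / a i0 j0" for i j
    obtain x where x: "\<exists>j\<in>J'. x j \<noteq> 0" "\<forall>i\<in>I. (\<Sum>j\<in>J'. b i j * x j) = 0"
      using insert.IH[OF J'(1,2), of b] by blast
    define y where "y = x(j0 := - (\<Sum>j\<in>J'. a i0 j * x j) / a i0 j0)"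
    have split: "(\<Sum>j\<in>J. a i j * y j) = a i j0 * y j0 + (\<Sum>j\<in>J'. a i j * x j)" for i
    proof -
      have "(\<Sum>j\<in>J'. a i j * y j) = (\<Sum>j\<in>J'. a i j * x j)"
        using J'(4) by (intro sum.cong) (auto simp: y_def)
      then show ?thesis using J' by simp
    qed
    have "(\<Sum>j\<in>J. a i j * y j) = 0" if "i \<in> I" for i
    proof -
      have "(\<Sum>j\<in>J'. b i j * x j)
          = (\<Sum>j\<in>J'. a i j * x j) - a i j0 / a i0 j0 * (\<Sum>j\<in>J'. a i0 j * x j)"
        by (simp add: b_def sum_distrib_left sum_subtractf[symmetric] algebra_simps)
      then show ?thesis using x(2) that unfolding split by (simp add: y_def)
    qed
    moreover have "(\<Sum>j\<in>J. a i0 j * y j) = 0"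
      unfolding split using j0 by (simp add: y_def)
    moreover have "\<exists>j\<in>J. y j \<noteq> 0"
    proof -
      obtain j where "j \<in> J'" "x j \<noteq> 0" using x(1) by blast
      then show ?thesis using J' by (intro bexI[of _ j]) (auto simp: y_def)
    qed
    ultimately show ?thesis by auto
  qed
qed

text \<open>The right-hand side is made homogeneous by an extra unknown \<open>None\<close>.
  Injectivity forces its value to be nonzero in a nontrivial solution, and dividing by that value
  solves the system.\<close>

lemma square_system_solvable:
  fixes a :: "'i \<Rightarrow> 'i \<Rightarrow> real"
  assumes "finite I"
    and inj: "\<And>x. (\<And>i. i \<in> I \<Longrightarrow> (\<Sum>j\<in>I. a i j * x j) = 0) \<Longrightarrow> \<forall>j\<in>I. x j = 0"
  shows "\<exists>x. \<forall>i\<in>I. (\<Sum>j\<in>I. a i j * x j) = v i"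
proof -
  define J where "J = insert None (Some ` I)"
  define b where "b i j = (case j of None \<Rightarrow> - v i | Some j \<Rightarrow> a i j)" for i j
  have "card (Some ` I) = card I" by (simp add: card_image)
  then have J: "finite J" "card I < card J" using assms(1) by (auto simp: J_def card_insert_if)
  obtain y where y: "\<exists>j\<in>J. y j \<noteq> 0" "\<forall>i\<in>I. (\<Sum>j\<in>J. b i j * y j) = 0"
    using underdetermined_homogeneous_system[OF assms(1) J, of b] by blast
  have split: "(\<Sum>j\<in>I. a i j * y (Some j)) = v i * y None" if "i \<in> I" for i
  proof -
    have "(\<Sum>j\<in>J. b i j * y j) = - v i * y None + (\<Sum>j\<in>I. a i j * y (Some j))"
      using assms(1) by (simp add: J_def b_def sum.reindex)
    then show ?thesis using y(2) that by simp
  qed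
  have "y None \<noteq> 0"
  proof
    assume "y None = 0"
    then have "\<forall>j\<in>I. y (Some j) = 0" using split by (intro inj) auto
    with \<open>y None = 0\<close> y(1) show False by (auto simp: J_def)
  qed
  then have "(\<Sum>j\<in>I. a i j * (y (Some j) / y None)) = v i" if "i \<in> I" for i
    using split[OF that] by (simp add: sum_divide_distrib[symmetric] field_simps)
  then show ?thesis by (intro exI[of _ "\<lambda>j. y (Some j) / y None"]) simp
qed

section \<open>The Laplacian of a well-balanced element\<close>

text \<open>For well-balanced \<open>f\<close> this is a weighted Laplacian on the Cayley graph with
  edges from \<open>t\<close> to \<open>t + s\<close>. Integrality of all its values is the
  condition that \<open>X_f\<close> imposes on a real lift.\<close>

definition laplace :: "('g::group_add \<Rightarrow> int) \<Rightarrow> ('g \<Rightarrow> real) \<Rightarrow> 'g \<Rightarrow> real" where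
  "laplace f x t = (\<Sum>s\<in>supp f. x (t + s) * of_int (f s))"

primrec word_ball :: "'g::group_add set \<Rightarrow> nat \<Rightarrow> 'g set" where
  "word_ball S 0 = {0}"
| "word_ball S (Suc n) = word_ball S n \<union> (\<lambda>(t, s). t + s) ` (word_ball S n \<times> S)"

lemma finite_word_ball: "finite S \<Longrightarrow> finite (word_ball S n)"
  by (induction n) auto

lemma word_ball_mono: "m \<le> n \<Longrightarrow> word_ball S m \<subseteq> word_ball S n"
  by (induction rule: dec_induct) auto

lemma zero_in_word_ball [simp]: "0 \<in> word_ball S n"
  using word_ball_mono[of 0 n S] by auto

lemma word_ball_step: "t \<in> word_ball S n \<Longrightarrow> s \<in> S \<Longrightarrow> t + s \<in> word_ball S (Suc n)"
  by force

lemma locally_constant_on_word_ball: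
  assumes "\<And>t s. t \<in> word_ball S n \<Longrightarrow> s \<in> S \<Longrightarrow> \<phi> (t + s) = \<phi> t"
    and "t \<in> word_ball S n"
  shows "\<phi> t = \<phi> 0"
proof -
  have "word_ball S m \<subseteq> {t. \<phi> t = \<phi> 0}" if "m \<le> n" for m
    using that
  proof (induction m)
    case (Suc m)
    have IH: "word_ball S m \<subseteq> {t. \<phi> t = \<phi> 0}" by (rule Suc.IH) (use Suc.prems in simp)
    have sub: "word_ball S m \<subseteq> word_ball S n" using Suc.prems by (intro word_ball_mono) simp
    have "\<phi> (t + s) = \<phi> 0" if "t \<in> word_ball S m" "s \<in> S" for t s
    proof -
      have "\<phi> (t + s) = \<phi> t" using assms(1) sub that by blast
      also have "\<dots> = \<phi> 0" using IH that(1) by blast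
      finally show ?thesis .
    qed
    then have "(\<lambda>(t, s). t + s) ` (word_ball S m \<times> S) \<subseteq> {t. \<phi> t = \<phi> 0}"
      by (intro image_subsetI) (simp only: mem_Times_iff split_beta mem_Collect_eq)
    with IH show ?case by (simp only: word_ball.simps Un_subset_iff)
  qed simp
  with assms(2) show ?thesis by blast
qed

locale balanced =
  fixes f :: "'g::group_add \<Rightarrow> int"
  assumes well_balanced: "well_balanced f"
begin

abbreviation "S \<equiv> supp f"
abbreviation "L \<equiv> laplace f"

lemma finite_S: "finite S"
  using well_balanced unfolding well_balanced_def by metis

lemma sum_f: "(\<Sum>s\<in>S. real_of_int (f s)) = 0"
proof -
  have "(\<Sum>s\<in>S. f s) = 0" using well_balanced unfolding well_balanced_def by blast
  then show ?thesis by (metis of_int_0 of_int_sum)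
qed

lemma f_uminus: "f (- s) = f s"
  using well_balanced unfolding well_balanced_def by metis

lemma S_uminus: "s \<in> S \<Longrightarrow> - s \<in> S"
  by (simp add: supp_def f_uminus)

lemma f_nonpos: "s \<noteq> 0 \<Longrightarrow> f s \<le> 0"
  using well_balanced unfolding well_balanced_def by metis

text \<open>Connectedness of the Cayley graph. The \<open>g\<close> for which right translation by
  both \<open>g\<close> and \<open>- g\<close> preserves \<open>A\<close> form a subgroup; it
  contains \<open>S\<close> because \<open>S\<close> is symmetric.\<close>

lemma S_closed_eq_UNIV:
  assumes "A \<noteq> {}" and closed: "\<And>a s. a \<in> A \<Longrightarrow> s \<in> S \<Longrightarrow> a + s \<in> A"
  shows "A = UNIV"
proof -
  define P where "P = {g. \<forall>a\<in>A. a + g \<in> A \<and> a - g \<in> A}"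
  have "is_subgroup P"
    unfolding is_subgroup_def
  proof (intro conjI ballI)
    fix a b assume "a \<in> P" "b \<in> P"
    then have "c + (a + b) \<in> A" "c - (a + b) \<in> A" if "c \<in> A" for c
      using that by (auto simp: P_def add.assoc[symmetric] diff_add_eq_diff_diff_swap)
    then show "a + b \<in> P" by (simp add: P_def)
  qed (auto simp: P_def)
  moreover have "S \<subseteq> P"
    using closed S_uminus unfolding P_def by (auto simp: diff_conv_add_uminus simp del: add_uminus_conv_diff)
  ultimately have "generated_subgroup S \<subseteq> P" by (auto simp: generated_subgroup_def)
  then have "P = UNIV" using well_balanced unfolding well_balanced_def by blast
  obtain a where "a \<in> A" using assms(1) by blast
  have "t \<in> A" for t
  proof -
    have "- a + t \<in> P" using \<open>P = UNIV\<close> by simp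
    then have "a + (- a + t) \<in> A" using \<open>a \<in> A\<close> by (auto simp: P_def)
    then show ?thesis by (simp add: add.assoc[symmetric])
  qed
  then show ?thesis by blast
qed

lemma in_word_ball: "\<exists>n. t \<in> word_ball S n"
proof -
  have "(\<Union>n. word_ball S n) = UNIV"
  proof (rule S_closed_eq_UNIV)
    show "(\<Union>n. word_ball S n) \<noteq> {}" using zero_in_word_ball by blast
  qed (use word_ball_step in blast)
  then show ?thesis by blast
qed

lemma finite_subset_word_ball:
  assumes "finite K"
  shows "\<exists>n. K \<subseteq> word_ball S n"
  using assms
proof (induction K rule: finite_induct)
  case (insert k K)
  then obtain m n where "K \<subseteq> word_ball S m" "k \<in> word_ball S n" using in_word_ball by blast
  then show ?case
    using word_ball_mono[of m "max m n" S] word_ball_mono[of n "max m n" S]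
    by (intro exI[of _ "max m n"]) auto
qed simp

lemma laplace_diff: "L x t = (\<Sum>s\<in>S. (x (t + s) - x t) * of_int (f s))"
  by (simp add: laplace_def left_diff_distrib sum_subtractf sum_distrib_left[symmetric] sum_f)

lemma laplace_minus: "L (\<lambda>t. - x t) t = - L x t"
  by (simp add: laplace_def sum_negf)

lemma laplace_add: "L (\<lambda>t. x t + y t) t = L x t + L y t"
  by (simp add: laplace_def sum.distrib algebra_simps)

lemma laplace_const [simp]: "L (\<lambda>t. c) t = 0"
  by (simp add: laplace_diff)

text \<open>At a maximum among the neighbours every product in \<open>laplace_diff\<close> is
  nonnegative. A vanishing sum of nonnegative terms has only vanishing terms, and \<open>f s\<close>
  is nonzero on \<open>S\<close>.\<close>

lemma maximum_principle:
  assumes "L x t = 0" and max: "\<And>s. s \<in> S \<Longrightarrow> x (t + s) \<le> x t" and "s \<in> S"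
  shows "x (t + s) = x t"
proof -
  have "(x (t + s) - x t) * of_int (f s) \<ge> 0" if "s \<in> S" for s
    using max[OF that] f_nonpos[of s] by (cases "s = 0") (auto intro!: mult_nonpos_nonpos)
  then have "\<forall>s\<in>S. (x (t + s) - x t) * of_int (f s) = 0"
    using assms(1) finite_S by (simp add: laplace_diff sum_nonneg_eq_0_iff)
  then show ?thesis using \<open>s \<in> S\<close> by (auto simp: supp_def)
qed

end

section \<open>Finite quotients\<close>

text \<open>Functions on the quotient are handled as right-periodic functions on the group. For
  normal \<open>H\<close> this is the same as invariance under the left shifts used in
  \<open>Fix\<close>.\<close>

definition periodic :: "'g::group_add set \<Rightarrow> ('g \<Rightarrow> 'a) \<Rightarrow> bool" where
  "periodic H x \<longleftrightarrow> (\<forall>h\<in>H. \<forall>t. x (t + h) = x t)"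

lemma finite_index_transversal:
  assumes "is_subgroup H" "finite_index H"
  shows "\<exists>T. finite T \<and> (\<forall>t. \<exists>!r. r \<in> T \<and> - r + t \<in> H)"
proof -
  define C where "C = {(\<lambda>h. g + h) ` H | g. True}"
  define p where "p c = (SOME g. g \<in> c)" for c :: "'a set"
  have zero: "0 \<in> H" and add: "\<And>a b. a \<in> H \<Longrightarrow> b \<in> H \<Longrightarrow> a + b \<in> H"
    and neg: "\<And>a. a \<in> H \<Longrightarrow> - a \<in> H"
    using assms(1) by (auto simp: is_subgroup_def)
  have mem: "t \<in> (\<lambda>h. g + h) ` H \<longleftrightarrow> - g + t \<in> H" for g t
    by (metis image_iff add.assoc add_minus_cancel minus_add_cancel)
  have coset_eq: "(\<lambda>h. g + h) ` H = (\<lambda>h. t + h) ` H" if "- g + t \<in> H" for g t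
  proof -
    have "- t + g \<in> H" using neg[OF that] by (simp add: minus_add)
    have "- g + x \<in> H \<longleftrightarrow> - t + x \<in> H" for x
      using add[OF that, of "- t + x"] add[OF \<open>- t + g \<in> H\<close>, of "- g + x"]
      by (auto simp: add.assoc)
    then show ?thesis using mem by blast
  qed
  have p: "- g + p ((\<lambda>h. g + h) ` H) \<in> H" for g
  proof -
    have "g \<in> (\<lambda>h. g + h) ` H" using zero by (simp add: mem)
    then have "p ((\<lambda>h. g + h) ` H) \<in> (\<lambda>h. g + h) ` H" unfolding p_def by (rule someI)
    then show ?thesis by (simp add: mem)
  qed
  have "finite (p ` C)" using assms(2) by (simp add: finite_index_def C_def)
  moreover have "\<exists>!r. r \<in> p ` C \<and> - r + t \<in> H" for t
  proof (rule ex1I)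
    let ?r = "p ((\<lambda>h. t + h) ` H)"
    have "- ?r + t \<in> H" using neg[OF p[of t]] by (simp add: minus_add)
    then show "?r \<in> p ` C \<and> - ?r + t \<in> H" by (auto simp: C_def)
    fix r assume r: "r \<in> p ` C \<and> - r + t \<in> H"
    then obtain g where g: "r = p ((\<lambda>h. g + h) ` H)" by (auto simp: C_def)
    then have "(\<lambda>h. g + h) ` H = (\<lambda>h. r + h) ` H" using coset_eq p by blast
    also have "\<dots> = (\<lambda>h. t + h) ` H" using coset_eq r by blast
    finally show "r = ?r" using g by simp
  qed
  ultimately show ?thesis by blast
qed

lemmas group_normalize = diff_conv_add_uminus minus_add add.assoc

locale balanced_quotient = balanced f for f :: "'g::group_add \<Rightarrow> int" +
  fixes H T :: "'g set"
  assumes normal: "is_normal_subgroup H"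
    and finite_T: "finite T"
    and transversal: "\<exists>!r. r \<in> T \<and> - r + t \<in> H"
begin

lemma zero_H: "0 \<in> H" and add_H: "a \<in> H \<Longrightarrow> b \<in> H \<Longrightarrow> a + b \<in> H"
  and minus_H: "- a \<in> H \<longleftrightarrow> a \<in> H"
  using normal unfolding is_normal_subgroup_def is_subgroup_def by (blast, blast, metis minus_minus)

text \<open>\<open>b + a\<close> is the conjugate of \<open>a + b\<close> by \<open>b\<close>. In
  this form normality makes congruence modulo \<open>H\<close> invariant under right translation,
  see \<open>cong_right\<close>.\<close>

lemma rotate_H: "a + b \<in> H \<longleftrightarrow> b + a \<in> H"
proof -
  have *: "b + a \<in> H" if "a + b \<in> H" for a b
  proof -
    have "b + (a + b) - b \<in> H" using normal that unfolding is_normal_subgroup_def by blast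
    then show ?thesis by (simp add: add.assoc[symmetric])
  qed
  then show ?thesis by blast
qed

lemma cong_sym: "- a + b \<in> H \<longleftrightarrow> - b + a \<in> H"
  using minus_H[of "- a + b"] by (simp add: minus_add)

lemma cong_trans: "- a + b \<in> H \<Longrightarrow> - b + c \<in> H \<Longrightarrow> - a + c \<in> H"
  using add_H[of "- a + b" "- b + c"] by (simp add: add.assoc)

lemma periodic_cong:
  assumes "periodic H x" "- a + b \<in> H"
  shows "x a = x b"
proof -
  have "x (a + (- a + b)) = x a" using assms unfolding periodic_def by blast
  then show ?thesis by (simp add: add.assoc[symmetric])
qed

lemma periodicI:
  assumes "\<And>a b. - a + b \<in> H \<Longrightarrow> x a = x b"
  shows "periodic H x"
  unfolding periodic_def
proof (intro ballI allI)
  fix h t assume "h \<in> H"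
  then show "x (t + h) = x t" using assms[of t "t + h"] by (simp add: add.assoc[symmetric])
qed

lemma cong_right: "- (a + g) + (b + g) \<in> H \<longleftrightarrow> - a + b \<in> H"
  using rotate_H[of "- g" "- a + (b + g)"] by (simp add: group_normalize del: add_uminus_conv_diff)

lemma cong_left: "- (g + a) + (g + b) \<in> H \<longleftrightarrow> - a + b \<in> H"
  by (simp add: group_normalize del: add_uminus_conv_diff)

lemma periodic_right: "periodic H x \<Longrightarrow> periodic H (\<lambda>t. x (t + g))"
  by (intro periodicI) (metis periodic_cong cong_right)

lemma periodic_left: "periodic H x \<Longrightarrow> periodic H (\<lambda>t. x (g + t))"
  by (intro periodicI) (metis periodic_cong cong_left)

lemma periodic_laplace: "periodic H x \<Longrightarrow> periodic H (L x)"
  using periodic_right[of x] by (auto simp: periodic_def laplace_def)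

definition rep :: "'g \<Rightarrow> 'g" where
  "rep t = (THE r. r \<in> T \<and> - r + t \<in> H)"

lemma rep_T: "rep t \<in> T" and rep_cong: "- rep t + t \<in> H"
  using theI'[OF transversal[of t]] by (auto simp: rep_def)

lemma rep_unique: "r \<in> T \<Longrightarrow> - r + t \<in> H \<Longrightarrow> rep t = r"
  using transversal[of t] rep_T rep_cong by blast

lemma rep_eq_iff: "rep a = rep b \<longleftrightarrow> - a + b \<in> H"
proof
  assume "rep a = rep b"
  then show "- a + b \<in> H" using rep_cong[of a] rep_cong[of b] cong_sym cong_trans by metis
next
  assume "- a + b \<in> H"
  then show "rep a = rep b" using rep_cong[of a] rep_T cong_trans rep_unique by metis
qed

lemma periodic_rep: "periodic H x \<Longrightarrow> x (rep t) = x t"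
  using periodic_cong rep_cong by blast

lemma periodic_comp_rep: "periodic H (\<lambda>t. x (rep t))"
  by (rule periodicI) (metis rep_eq_iff)

lemma T_nonempty: "T \<noteq> {}"
  using rep_T by blast

lemma rep_on_T: "t \<in> T \<Longrightarrow> rep t = t"
  by (rule rep_unique) (auto simp: zero_H)

text \<open>By the first assumption \<open>\<phi>\<close> followed by \<open>rep\<close> is
  injective on the finite set \<open>T\<close>, hence permutes it.\<close>

lemma sum_reindex_periodic:
  fixes x :: "'g \<Rightarrow> real"
  assumes "\<And>a b. - \<phi> a + \<phi> b \<in> H \<Longrightarrow> - a + b \<in> H" and x: "periodic H x"
  shows "(\<Sum>t\<in>T. x (\<phi> t)) = (\<Sum>t\<in>T. x t)"
proof -
  have "inj_on (\<lambda>t. rep (\<phi> t)) T"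
  proof (rule inj_onI)
    fix a b assume "a \<in> T" "b \<in> T" "rep (\<phi> a) = rep (\<phi> b)"
    then have "rep a = rep b" using assms(1) by (simp add: rep_eq_iff)
    with \<open>a \<in> T\<close> \<open>b \<in> T\<close> show "a = b" by (simp add: rep_on_T)
  qed
  moreover have "(\<lambda>t. rep (\<phi> t)) ` T \<subseteq> T" using rep_T by blast
  ultimately have "bij_betw (\<lambda>t. rep (\<phi> t)) T T"
    using endo_inj_surj[OF finite_T] by (auto simp: bij_betw_def)
  from sum.reindex_bij_betw[OF this, of x] show ?thesis by (simp add: periodic_rep[OF x])
qed

lemma sum_right:
  fixes x :: "'g \<Rightarrow> real"
  shows "periodic H x \<Longrightarrow> (\<Sum>t\<in>T. x (t + g)) = (\<Sum>t\<in>T. x t)"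
  by (rule sum_reindex_periodic) (simp_all add: cong_right)

lemma sum_left:
  fixes x :: "'g \<Rightarrow> real"
  shows "periodic H x \<Longrightarrow> (\<Sum>t\<in>T. x (g + t)) = (\<Sum>t\<in>T. x t)"
  by (rule sum_reindex_periodic) (simp_all add: cong_left)

definition delta :: "'g \<Rightarrow> 'g \<Rightarrow> real" where
  "delta j t = (if - t + j \<in> H then 1 else 0)"

lemma periodic_delta: "periodic H (delta j)"
  by (intro periodicI) (auto simp: delta_def intro: cong_trans dest: cong_sym[THEN iffD1])

lemma sum_delta: "periodic H x \<Longrightarrow> (\<Sum>t\<in>T. delta j t * x t) = x j"
proof -
  assume x: "periodic H x"
  have "(\<Sum>t\<in>T. delta j t * x t) = (\<Sum>t\<in>T. if rep j = t then x j else 0)"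
    using rep_unique[of _ j] rep_cong[of j] periodic_rep[OF x, of j]
    by (intro sum.cong) (auto simp: delta_def)
  then show ?thesis using finite_T rep_T by simp
qed

text \<open>Summation by parts: translation by \<open>s\<close> moves to the other factor as
  translation by \<open>- s\<close>, and \<open>f\<close> is even.\<close>

lemma laplace_self_adjoint:
  assumes x: "periodic H x" and y: "periodic H y"
  shows "(\<Sum>t\<in>T. L x t * y t) = (\<Sum>t\<in>T. x t * L y t)"
proof -
  have shift: "(\<Sum>t\<in>T. x (t + s) * y t) = (\<Sum>t\<in>T. x t * y (t + - s))" for s
  proof -
    have "periodic H (\<lambda>t. x t * y (t + - s))"
      using x periodic_right[OF y, of "- s"] by (auto simp: periodic_def)
    from sum_right[OF this, of s] show ?thesis by (simp add: add.assoc)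
  qed
  have "(\<Sum>t\<in>T. L x t * y t) = (\<Sum>s\<in>S. of_int (f s) * (\<Sum>t\<in>T. x (t + s) * y t))"
    unfolding laplace_def sum_distrib_right sum_distrib_left
    by (subst sum.swap) (simp add: ac_simps)
  also have "\<dots> = (\<Sum>s\<in>S. of_int (f (- s)) * (\<Sum>t\<in>T. x t * y (t + - s)))"
    by (simp only: shift f_uminus)
  also have "\<dots> = (\<Sum>s\<in>S. of_int (f s) * (\<Sum>t\<in>T. x t * y (t + s)))"
    by (rule sum.reindex_bij_witness[of _ uminus uminus]) (auto simp: S_uminus)
  also have "\<dots> = (\<Sum>t\<in>T. x t * L y t)"
    unfolding laplace_def sum_distrib_right sum_distrib_left
    by (subst sum.swap) (simp add: ac_simps)
  finally show ?thesis .
qed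

text \<open>The Dirichlet energy identity. After expanding the square, the two pure squares have
  sums independent of \<open>s\<close> by translation invariance and cancel because \<open>f\<close>
  has total sum zero; the cross terms remain.\<close>

lemma energy:
  assumes x: "periodic H x"
  shows "2 * (\<Sum>t\<in>T. x t * L x t) = (\<Sum>t\<in>T. \<Sum>s\<in>S. - of_int (f s) * (x (t + s) - x t)\<^sup>2)"
proof -
  have sq: "(\<Sum>t\<in>T. (x (t + s))\<^sup>2) = (\<Sum>t\<in>T. (x t)\<^sup>2)" for s
    using x by (intro sum_right) (auto simp: periodic_def)
  have "(\<Sum>t\<in>T. \<Sum>s\<in>S. - of_int (f s) * (x (t + s) - x t)\<^sup>2)
      = (\<Sum>s\<in>S. of_int (f s) * (2 * (\<Sum>t\<in>T. x t * x (t + s)) - (\<Sum>t\<in>T. (x (t + s))\<^sup>2) - (\<Sum>t\<in>T. (x t)\<^sup>2)))"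
    by (subst sum.swap)
       (simp add: sum_distrib_left sum_subtractf[symmetric] power2_eq_square algebra_simps)
  also have "\<dots> = 2 * (\<Sum>s\<in>S. of_int (f s) * (\<Sum>t\<in>T. x t * x (t + s)))
      - (\<Sum>s\<in>S. of_int (f s)) * (2 * (\<Sum>t\<in>T. (x t)\<^sup>2))"
    unfolding sq sum_distrib_right sum_distrib_left[of 2 _ S] sum_subtractf[symmetric]
    by (rule sum.cong) (simp_all add: algebra_simps)
  also have "(\<Sum>s\<in>S. of_int (f s) * (\<Sum>t\<in>T. x t * x (t + s))) = (\<Sum>t\<in>T. x t * L x t)"
    unfolding laplace_def sum_distrib_left by (subst sum.swap) (simp add: ac_simps)
  finally show ?thesis by (simp add: sum_f)
qed

lemma periodic_attains_max:
  fixes x :: "'g \<Rightarrow> real"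
  assumes "periodic H x"
  obtains m where "\<And>t. x t \<le> x m"
proof -
  have "Max (x ` T) \<in> x ` T" using finite_T T_nonempty by simp
  then obtain m where m: "x m = Max (x ` T)" by auto
  have "x (rep t) \<le> x m" for t
    unfolding m using finite_T rep_T by (intro Max_ge) auto
  then show ?thesis using that[of m] by (simp add: periodic_rep[OF assms])
qed

lemma harmonic_periodic_const:
  assumes x: "periodic H x" and "\<And>t. L x t = 0"
  shows "x t = x 0"
proof -
  obtain m where m: "\<And>t. x t \<le> x m" using periodic_attains_max[OF x] by blast
  have "{t. x t = x m} = UNIV"
  proof (rule S_closed_eq_UNIV)
    fix a s assume "a \<in> {t. x t = x m}" "s \<in> S"
    then show "a + s \<in> {t. x t = x m}" using maximum_principle[of x a s] assms(2) m by simp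
  qed auto
  then show ?thesis by (metis UNIV_I mem_Collect_eq)
qed

lemma sum_laplace: "periodic H x \<Longrightarrow> (\<Sum>t\<in>T. L x t) = 0"
  using laplace_self_adjoint[of x "\<lambda>_. 1"] by (simp add: periodic_def)

text \<open>The Fredholm alternative on the finite quotient: periodic harmonic functions are
  constant, so the mean of \<open>v\<close> is the only obstruction.\<close>

lemma laplace_solvable:
  assumes v: "periodic H v" and "(\<Sum>t\<in>T. v t) = 0"
  obtains x where "periodic H x" "\<And>t. L x t = v t"
proof -
  \<comment> \<open>The added \<open>1\<close> puts the total sum of \<open>x\<close> into every
    equation, which removes the constants from the kernel. Summing the equations over
    \<open>T\<close> shows that this extra term vanishes whenever the right-hand side has sum
    zero.\<close>
  define a where "a i j = (\<Sum>s\<in>S. if rep (i + s) = j then of_int (f s) else 0) + (1::real)" for i j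
  have a: "(\<Sum>j\<in>T. a i j * x j) = L (\<lambda>t. x (rep t)) i + (\<Sum>j\<in>T. x j)" for i x
  proof -
    have "(\<Sum>j\<in>T. (\<Sum>s\<in>S. if rep (i + s) = j then of_int (f s) else 0) * x j)
        = (\<Sum>s\<in>S. \<Sum>j\<in>T. if rep (i + s) = j then of_int (f s) * x j else 0)"
      unfolding sum_distrib_right by (subst sum.swap) (auto intro!: sum.cong)
    also have "\<dots> = (\<Sum>s\<in>S. of_int (f s) * x (rep (i + s)))"
      using finite_T rep_T by simp
    also have "\<dots> = L (\<lambda>t. x (rep t)) i"
      by (simp add: laplace_def mult.commute)
    finally show ?thesis by (simp add: a_def distrib_right sum.distrib)
  qed
  have sum_zero: "(\<Sum>j\<in>T. x j) = 0" and solves: "\<And>t. L (\<lambda>t. x (rep t)) t = w t"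
    if w: "periodic H w" "(\<Sum>t\<in>T. w t) = 0" and eq: "\<And>i. i \<in> T \<Longrightarrow> (\<Sum>j\<in>T. a i j * x j) = w i" for x w
  proof -
    have "0 = (\<Sum>i\<in>T. \<Sum>j\<in>T. a i j * x j)" using w(2) eq by simp
    also have "\<dots> = card T * (\<Sum>j\<in>T. x j)"
      by (simp add: a sum.distrib sum_laplace periodic_comp_rep)
    finally show z: "(\<Sum>j\<in>T. x j) = 0" using finite_T T_nonempty by auto
    fix t
    have "L (\<lambda>t. x (rep t)) (rep t) = w (rep t)" using eq[OF rep_T] a z by simp
    then show "L (\<lambda>t. x (rep t)) t = w t"
      using periodic_rep[OF periodic_laplace[OF periodic_comp_rep]] periodic_rep[OF w(1)] by simp
  qed
  have "\<exists>x. \<forall>i\<in>T. (\<Sum>j\<in>T. a i j * x j) = v i"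
  proof (rule square_system_solvable[OF finite_T])
    fix x assume x: "\<And>i. i \<in> T \<Longrightarrow> (\<Sum>j\<in>T. a i j * x j) = 0"
    have zero: "periodic H (\<lambda>_. 0)" by (simp add: periodic_def)
    have c: "x (rep t) = x (rep 0)" for t
      using harmonic_periodic_const[OF periodic_comp_rep, of x t] solves[OF zero _ x] by simp
    then have "x j = x (rep 0)" if "j \<in> T" for j using rep_on_T[OF that] by metis
    then have "card T * x (rep 0) = 0" using sum_zero[OF zero _ x] by simp
    then have "x (rep 0) = 0" using finite_T T_nonempty by auto
    then show "\<forall>j\<in>T. x j = 0" using \<open>\<And>j. j \<in> T \<Longrightarrow> x j = x (rep 0)\<close> by simp
  qed
  then obtain x where "\<And>i. i \<in> T \<Longrightarrow> (\<Sum>j\<in>T. a i j * x j) = v i" by blast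
  from solves[OF v assms(2) this] show ?thesis using periodic_comp_rep that by blast
qed

end

section \<open>Integral potentials\<close>

context balanced_quotient
begin

text \<open>The push-forward of \<open>h\<close> on \<open>K\<close> to the quotient; coefficients
  of points of \<open>K\<close> in the same class add up.\<close>

definition periodization :: "'g set \<Rightarrow> ('g \<Rightarrow> int) \<Rightarrow> 'g \<Rightarrow> real" where
  "periodization K h t = (\<Sum>k\<in>K. of_int (h k) * delta k t)"

lemma periodic_periodization: "periodic H (periodization K h)"
  using periodic_delta by (auto simp: periodic_def periodization_def)

lemma sum_periodization:
  assumes "periodic H x"
  shows "(\<Sum>t\<in>T. periodization K h t * x t) = (\<Sum>k\<in>K. of_int (h k) * x k)"
  unfolding periodization_def sum_distrib_right
  by (subst sum.swap) (simp add: mult.assoc sum_distrib_left[symmetric] sum_delta[OF assms])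

text \<open>The hypothesis says that the character \<open>h\<close> is trivial on periodic points.
  For a real potential \<open>u\<close>, self-adjointness turns \<open>u i - u 0\<close> into the
  pairing of \<open>h\<close> with a periodic \<open>x\<close> whose Laplacian is
  \<open>delta i - delta 0\<close>. Such an \<open>x\<close> is admissible in the hypothesis, so
  these differences are integers.\<close>

lemma integral_potential:
  fixes h :: "'g \<Rightarrow> int"
  assumes annih: "\<And>x. periodic H x \<Longrightarrow> (\<And>t. L x t \<in> \<int>) \<Longrightarrow> (\<Sum>k\<in>K. of_int (h k) * x k) \<in> \<int>"
  obtains v :: "'g \<Rightarrow> int" where "periodic H v"
    "\<And>t. L (\<lambda>t. of_int (v t)) t = periodization K h t"
proof -
  have const: "periodic H (\<lambda>_. c)" for c :: real by (simp add: periodic_def)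
  have "(\<Sum>k\<in>K. real_of_int (h k)) = 0"
  proof (rule ccontr)
    define c where "c = (\<Sum>k\<in>K. real_of_int (h k))"
    assume "(\<Sum>k\<in>K. real_of_int (h k)) \<noteq> 0"
    then have "c \<noteq> 0" by (simp add: c_def)
    \<comment> \<open>Constants are harmonic, so \<open>1 / (2 * c)\<close> is admissible in
      \<open>annih\<close>, but it pairs with \<open>h\<close> to one half.\<close>
    have "(\<Sum>k\<in>K. real_of_int (h k) * (1 / (2 * c))) \<in> \<int>"
      by (rule annih[OF const]) simp
    then have "c * (1 / (2 * c)) \<in> \<int>" unfolding c_def sum_distrib_right .
    then have "(1 / 2 :: real) \<in> \<int>" using \<open>c \<noteq> 0\<close> by simp
    then obtain n :: int where "(1 / 2 :: real) = of_int n" by (auto elim: Ints_cases)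
    then have "real_of_int (2 * n) = real_of_int 1" by simp
    then have "2 * n = 1" by (simp only: of_int_eq_iff)
    then show False by presburger
  qed
  then have "(\<Sum>t\<in>T. periodization K h t) = 0"
    using sum_periodization[OF const[of 1], of K h] by simp
  then obtain u where u: "periodic H u" "\<And>t. L u t = periodization K h t"
    using laplace_solvable[OF periodic_periodization] by blast
  have "u i - u 0 \<in> \<int>" for i
  proof -
    define w where "w t = delta i t - delta 0 t" for t
    have w: "periodic H w" using periodic_delta by (auto simp: periodic_def w_def)
    have "(\<Sum>t\<in>T. w t) = 0"
      using sum_delta[OF const[of 1]] by (simp add: w_def sum_subtractf)
    then obtain x where x: "periodic H x" "\<And>t. L x t = w t"
      using laplace_solvable[OF w] by blast
    have "(\<Sum>k\<in>K. of_int (h k) * x k) = (\<Sum>t\<in>T. L u t * x t)"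
      by (simp add: u(2) sum_periodization[OF x(1)])
    also have "\<dots> = (\<Sum>t\<in>T. u t * w t)"
      by (simp add: laplace_self_adjoint[OF u(1) x(1)] x(2))
    also have "\<dots> = (\<Sum>t\<in>T. delta i t * u t) - (\<Sum>t\<in>T. delta 0 t * u t)"
      by (simp add: w_def sum_subtractf[symmetric] algebra_simps)
    also have "\<dots> = u i - u 0" by (simp add: sum_delta[OF u(1)])
    finally show ?thesis using annih[OF x(1)] by (simp add: x(2) w_def delta_def)
  qed
  then have int: "of_int \<lfloor>u t - u 0\<rfloor> = u t - u 0" for t by simp
  show ?thesis
  proof (rule that[of "\<lambda>t. \<lfloor>u t - u 0\<rfloor>"])
    show "periodic H (\<lambda>t. \<lfloor>u t - u 0\<rfloor>)" using u(1) by (simp add: periodic_def)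
    show "L (\<lambda>t. of_int \<lfloor>u t - u 0\<rfloor>) t = periodization K h t" for t
      using laplace_add[of u "\<lambda>_. - u 0" t] unfolding int by (simp add: u(2))
  qed
qed

text \<open>Away from the classes of \<open>K\<close> the function is harmonic, so a set of maximum
  points missing \<open>K\<close> would be closed under edges and hence be everything.\<close>

lemma potential_attains_max:
  assumes x: "periodic H x" and Lx: "\<And>t. L x t = periodization K h t" and "k0 \<in> K"
  obtains k where "k \<in> K" "\<And>t. x t \<le> x k"
proof -
  obtain m where m: "\<And>t. x t \<le> x m" using periodic_attains_max[OF x] by blast
  have "\<exists>k\<in>K. x k = x m"
  proof (rule ccontr)
    assume no: "\<not> (\<exists>k\<in>K. x k = x m)"
    have "{t. x t = x m} = UNIV"
    proof (rule S_closed_eq_UNIV)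
      fix a s assume a: "a \<in> {t. x t = x m}" "s \<in> S"
      have "delta k a = 0" if "k \<in> K" for k
        using no that a(1) periodic_cong[OF x, of a k] by (auto simp: delta_def)
      then have "L x a = 0" by (simp add: Lx periodization_def)
      then show "a + s \<in> {t. x t = x m}" using maximum_principle[of x a s] a m by simp
    qed auto
    then show False using no \<open>k0 \<in> K\<close> by blast
  qed
  with m that show ?thesis by metis
qed

text \<open>The bound does not depend on \<open>H\<close>. Each edge jump is at most
  \<open>J\<close>, the square root of the energy \<open>E\<close>, so paths inside the ball bound
  the oscillation by \<open>2 * d * J\<close>. Pairing with \<open>h\<close> bounds \<open>E\<close>
  by \<open>2 * N\<close> times the oscillation. Together \<open>J * J \<le> 4 * N * d * J\<close>,
  which bounds \<open>J\<close> itself.\<close>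

lemma potential_oscillation:
  assumes x: "periodic H x" and Lx: "\<And>t. L x t = periodization K h t"
    and "finite K" and K: "K \<subseteq> word_ball S d" and "K \<noteq> {}"
  shows "x a - x b \<le> 8 * (real d)\<^sup>2 * (\<Sum>k\<in>K. \<bar>of_int (h k)\<bar>)"
proof -
  define N where "N = (\<Sum>k\<in>K. \<bar>real_of_int (h k)\<bar>)"
  define E where "E = 2 * (\<Sum>t\<in>T. x t * L x t)"
  define J where "J = sqrt E"
  have "N \<ge> 0" unfolding N_def by (intro sum_nonneg) simp
  obtain p where p: "p \<in> K" "\<And>t. x t \<le> x p"
    using potential_attains_max[OF x Lx] assms(5) by blast
  have "periodic H (\<lambda>t. - x t)" using x by (simp add: periodic_def)
  moreover have "L (\<lambda>t. - x t) t = periodization K (\<lambda>k. - h k) t" for t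
    by (simp add: laplace_minus Lx periodization_def sum_negf)
  ultimately obtain q where q: "q \<in> K" "\<And>t. x q \<le> x t"
    using potential_attains_max[of "\<lambda>t. - x t" K "\<lambda>k. - h k"] assms(5) by (metis all_not_in_conv neg_le_iff_le)
  have term_nonneg: "0 \<le> - of_int (f s) * (x (t + s) - x t)\<^sup>2" for s t
    using f_nonpos[of s] by (cases "s = 0") (auto intro!: mult_nonpos_nonneg)
  have E: "E = (\<Sum>t\<in>T. \<Sum>s\<in>S. - of_int (f s) * (x (t + s) - x t)\<^sup>2)"
    unfolding E_def by (rule energy[OF x])
  have "0 \<le> E" unfolding E by (intro sum_nonneg term_nonneg)
  have edge: "\<bar>x (t + s) - x t\<bar> \<le> J" if "s \<in> S" for t s
  proof -
    \<comment> \<open>Integrality of \<open>f\<close> gives every edge with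
      \<open>s \<noteq> 0\<close> a weight of at least one.\<close>
    have "(x (t + s) - x t)\<^sup>2 \<le> - of_int (f s) * (x (t + s) - x t)\<^sup>2"
    proof (cases "s = 0")
      case False
      then have "f s \<le> -1" using f_nonpos[of s] that by (simp add: supp_def)
      then have "1 \<le> - real_of_int (f s)" by simp
      from mult_right_mono[OF this, of "(x (t + s) - x t)\<^sup>2"] show ?thesis by simp
    qed simp
    also have "\<dots> = - of_int (f s) * (x (rep t + s) - x (rep t))\<^sup>2"
      using periodic_rep[OF x, of t] periodic_rep[OF periodic_right[OF x, of s], of t] by simp
    also have "\<dots> \<le> (\<Sum>s\<in>S. - of_int (f s) * (x (rep t + s) - x (rep t))\<^sup>2)"
      by (rule member_le_sum[OF that term_nonneg finite_S])
    also have "\<dots> \<le> E"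
      unfolding E by (rule member_le_sum[OF rep_T sum_nonneg[OF term_nonneg] finite_T])
    finally have "\<bar>x (t + s) - x t\<bar>\<^sup>2 \<le> E" by simp
    then show ?thesis unfolding J_def by (rule real_le_rsqrt)
  qed
  have path: "\<bar>x t - x 0\<bar> \<le> n * J" if "t \<in> word_ball S n" for t n
    using that
  proof (induction n arbitrary: t)
    case (Suc n)
    have "0 \<le> J" using \<open>0 \<le> E\<close> by (simp add: J_def)
    show ?case
    proof (cases "t \<in> word_ball S n")
      case True
      then show ?thesis using Suc.IH[OF True] \<open>0 \<le> J\<close> by (simp add: algebra_simps)
    next
      case False
      then obtain r s where "t = r + s" "r \<in> word_ball S n" "s \<in> S" using Suc.prems by auto
      then show ?thesis using Suc.IH[of r] edge[of s r] by (simp add: algebra_simps)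
    qed
  qed simp
  have pq: "x p - x q \<le> 2 * d * J"
  proof -
    have "p \<in> word_ball S d" "q \<in> word_ball S d" using p(1) q(1) K by auto
    from path[OF this(1)] path[OF this(2)] show ?thesis by (simp add: abs_le_iff)
  qed
  have sum_zero: "(\<Sum>k\<in>K. real_of_int (h k)) = 0"
    using sum_periodization[of "\<lambda>_. 1" K h] sum_laplace[OF x] by (simp add: Lx periodic_def)
  have "E = 2 * (\<Sum>k\<in>K. of_int (h k) * x k)"
    using sum_periodization[OF x, of K h] by (simp add: E_def Lx mult.commute)
  \<comment> \<open>The coefficients of \<open>h\<close> sum to zero, so the minimum
    \<open>x q\<close> can be subtracted, which makes the factors of \<open>h k\<close>
    nonnegative.\<close>
  also have "(\<Sum>k\<in>K. of_int (h k) * x k) = (\<Sum>k\<in>K. of_int (h k) * (x k - x q))"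
    using sum_zero by (simp add: right_diff_distrib sum_subtractf sum_distrib_right[symmetric])
  also have "\<dots> \<le> (\<Sum>k\<in>K. \<bar>of_int (h k)\<bar> * (x p - x q))"
  proof (rule sum_mono)
    fix k
    have "of_int (h k) * (x k - x q) \<le> \<bar>of_int (h k)\<bar> * (x k - x q)"
      using q(2) by (intro mult_right_mono) auto
    also have "\<dots> \<le> \<bar>of_int (h k)\<bar> * (x p - x q)"
      using p(2) by (intro mult_left_mono) auto
    finally show "of_int (h k) * (x k - x q) \<le> \<bar>of_int (h k)\<bar> * (x p - x q)" .
  qed
  also have "\<dots> = N * (x p - x q)" by (simp add: N_def sum_distrib_right)
  also have "\<dots> \<le> N * (2 * d * J)" using pq \<open>N \<ge> 0\<close> by (rule mult_left_mono)
  finally have "J * J \<le> (4 * N * d) * J" using \<open>0 \<le> E\<close> by (simp add: J_def algebra_simps)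
  moreover have "0 \<le> J" using \<open>0 \<le> E\<close> by (simp add: J_def)
  ultimately have "J \<le> 4 * N * d"
    using \<open>N \<ge> 0\<close> by (cases "J = 0") (auto simp: mult_le_cancel_right)
  then have "2 * d * J \<le> 2 * d * (4 * N * d)" by (rule mult_left_mono) simp
  then have "x p - x q \<le> 8 * (real d)\<^sup>2 * N" using pq by (simp add: power2_eq_square algebra_simps)
  then show ?thesis using p(2)[of a] q(2)[of b] unfolding N_def by linarith
qed

section \<open>Localization of the jumps of an integral potential\<close>

definition near :: "nat \<Rightarrow> 'g \<Rightarrow> bool" where
  "near r t \<longleftrightarrow> (\<exists>a\<in>word_ball S r. - a + t \<in> H)"

text \<open>A point where the integral potential jumps and is harmonic has a neighbour with a value
  larger by at least one; climbing like this must end in the support of the periodization.\<close>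

lemma jump_near:
  fixes v :: "'g \<Rightarrow> int"
  assumes v: "periodic H v" and Lv: "\<And>t. L (\<lambda>t. of_int (v t)) t = periodization K h t"
    and K: "K \<subseteq> word_ball S d" and max: "\<And>t. v t \<le> M"
    and "v t + int n \<ge> M" "s \<in> S" "v (t + s) \<noteq> v t"
  shows "near (d + n) t"
  using assms(5-)
proof (induction n arbitrary: t s)
  case 0
  then have top: "v t = M" using max[of t] by simp
  have "\<exists>k\<in>K. - k + t \<in> H"
  proof (rule ccontr)
    assume "\<not> ?thesis"
    then have "L (\<lambda>t. of_int (v t)) t = 0" by (simp add: Lv periodization_def delta_def cong_sym[of t])
    from maximum_principle[OF this _ \<open>s \<in> S\<close>] show False using 0 top max by auto
  qed
  then show ?case using K by (auto simp: near_def)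
next
  case (Suc n)
  show ?case
  proof (cases "\<exists>k\<in>K. - k + t \<in> H")
    case True
    then show ?thesis using K word_ball_mono[OF le_add1, of S d "Suc n"] unfolding near_def by blast
  next
    case False
    then have "L (\<lambda>t. of_int (v t)) t = 0" by (simp add: Lv periodization_def delta_def cong_sym[of t])
    from maximum_principle[OF this _ \<open>s \<in> S\<close>] obtain s' where s': "s' \<in> S" "v (t + s') > v t"
      using Suc.prems by (metis linorder_not_less of_int_le_iff of_int_eq_iff)
    \<comment> \<open>The value at \<open>t + s'\<close> is larger by at least one, so
      \<open>n\<close> suffices there in place of \<open>Suc n\<close>; the edge back along
      \<open>- s'\<close> is the jump that the induction hypothesis asks for.\<close>
    have "near (d + n) (t + s')"
      using Suc.prems s' by (intro Suc.IH[of "t + s'" "- s'"]) (auto simp: S_uminus add.assoc)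
    then obtain a where a: "a \<in> word_ball S (d + n)" "- a + (t + s') \<in> H" by (auto simp: near_def)
    have "- (a + - s') + t \<in> H"
      using a(2) rotate_H[of "- a + t" s'] by (simp add: group_normalize del: add_uminus_conv_diff)
    moreover have "a + - s' \<in> word_ball S (d + Suc n)"
      using word_ball_step[OF a(1) S_uminus[OF s'(1)]] by simp
    ultimately show ?thesis unfolding near_def by blast
  qed
qed

text \<open>Equivalently, in the quotient the image of the ball of radius \<open>r\<close> is
  disjoint from its left translate by \<open>g\<close>.\<close>

definition far :: "nat \<Rightarrow> 'g \<Rightarrow> bool" where
  "far r g \<longleftrightarrow> (\<forall>a\<in>word_ball S r. \<forall>b\<in>word_ball S r. - (a - b) + g \<notin> H)"

text \<open>\<open>A\<close> is compared with its translate \<open>A'\<close> by \<open>g\<close>.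
  Both contain equally many classes, but edges leaving or entering them start in two disjoint balls,
  about \<open>0\<close> and about \<open>g\<close>, and each set is constant on the ball of the
  other. Connectedness then leaves two cases: nested, which equal counts exclude, or covering the
  quotient with an overlap.\<close>

lemma far_level_majority:
  assumes per: "periodic H (\<lambda>t. t \<in> A)"
    and jump: "\<And>t s. \<not> near r t \<Longrightarrow> s \<in> S \<Longrightarrow> t + s \<in> A \<longleftrightarrow> t \<in> A"
    and far: "far r g" and "g \<in> A" and "A \<noteq> UNIV"
  shows "2 * (\<Sum>t\<in>T. of_bool (t \<in> A)) > real (card T)"
proof -
  define A' where "A' = {t. - g + t \<in> A}"
  have mem': "t \<in> A' \<longleftrightarrow> - g + t \<in> A" for t by (simp add: A'_def)
  have per': "periodic H (\<lambda>t. t \<in> A')" unfolding mem' by (rule periodic_left[OF per])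
  have disjoint: "\<not> near r t \<or> \<not> near r (- g + t)" for t
  proof (rule ccontr)
    assume "\<not> ?thesis"
    then obtain a b where ab: "a \<in> word_ball S r" "b \<in> word_ball S r"
      and a: "- a + t \<in> H" and b: "- b + (- g + t) \<in> H" by (auto simp: near_def)
    have "- b + (- g + t) + (- t + a) \<in> H" using b a cong_sym add_H by blast
    then have "- (g + b) + a \<in> H" by (simp add: group_normalize del: add_uminus_conv_diff)
    then have "- a + (g + b) \<in> H" using cong_sym by blast
    then have "- (a - b) + g \<in> H"
      using rotate_H[of "- a + g" b] by (simp add: group_normalize del: add_uminus_conv_diff)
    with far ab show False by (simp add: far_def)
  qed
  have jump': "t + s \<in> A' \<longleftrightarrow> t \<in> A'" if "\<not> near r (- g + t)" "s \<in> S" for t s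
    using jump[OF that] by (simp only: mem' add.assoc)
  have near_self: "near r b" if "b \<in> word_ball S r" for b
    using that zero_H unfolding near_def by (intro bexI[of _ b]) auto
  have near1: "t \<in> A' \<longleftrightarrow> 0 \<in> A'" if near: "near r t" for t
  proof -
    obtain a where a: "a \<in> word_ball S r" "- a + t \<in> H" using near by (auto simp: near_def)
    have "(a \<in> A') = (0 \<in> A')"
      by (rule locally_constant_on_word_ball[OF _ a(1)]) (use jump' disjoint near_self in blast)
    then show ?thesis using periodic_cong[OF per' a(2)] by simp
  qed
  have near2: "t \<in> A" if near: "near r (- g + t)" for t
  proof -
    obtain b where b: "b \<in> word_ball S r" "- b + (- g + t) \<in> H" using near by (auto simp: near_def)
    have "(g + b \<in> A) = (g + 0 \<in> A)"
    proof (rule locally_constant_on_word_ball[OF _ b(1)])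
      fix c s assume c: "c \<in> word_ball S r" and "s \<in> S"
      have "near r (- g + (g + c))" using near_self[OF c] by simp
      then show "(g + (c + s) \<in> A) = (g + c \<in> A)"
        using jump[of "g + c" s] disjoint[of "g + c"] \<open>s \<in> S\<close> by (simp add: add.assoc)
    qed
    moreover have "- (g + b) + t \<in> H" using b(2) by (simp add: group_normalize del: add_uminus_conv_diff)
    ultimately show ?thesis using periodic_cong[OF per] \<open>g \<in> A\<close> by (metis add_0_right)
  qed
  have not_closed: "\<not> (\<forall>t\<in>A. \<forall>s\<in>S. t + s \<in> A)"
    using S_closed_eq_UNIV[of A] \<open>g \<in> A\<close> \<open>A \<noteq> UNIV\<close> by blast
  have count': "(\<Sum>t\<in>T. of_bool (t \<in> A')) = (\<Sum>t\<in>T. of_bool (t \<in> A) :: real)"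
    using sum_left[of "\<lambda>t. of_bool (t \<in> A)" "- g"] per by (simp add: mem' periodic_def)
  have "0 \<in> A'"
  proof (rule ccontr)
    assume "0 \<notin> A'"
    \<comment> \<open>If \<open>A'\<close> misses the ball about \<open>0\<close>, points of
      \<open>A' - A\<close> lie in neither ball, so no edge leaves this set. Thus \<open>A'\<close>
      is contained in \<open>A\<close>, equal counts make them equal, and their jumps would coincide
      although the balls are disjoint.\<close>
    have "A' - A = {}"
    proof (rule ccontr)
      assume "A' - A \<noteq> {}"
      then have "A' - A = UNIV"
      proof (rule S_closed_eq_UNIV)
        fix t s assume "t \<in> A' - A" "s \<in> S"
        then show "t + s \<in> A' - A" using near1 near2 jump jump' \<open>0 \<notin> A'\<close> by blast
      qed
      then show False using \<open>g \<in> A\<close> by blast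
    qed
    then have "(\<Sum>t\<in>T. of_bool (t \<in> A) - of_bool (t \<in> A') :: real) = 0 \<longleftrightarrow>
        (\<forall>t\<in>T. of_bool (t \<in> A) - of_bool (t \<in> A') = (0::real))"
      using finite_T by (intro sum_nonneg_eq_0_iff) auto
    then have "\<forall>t\<in>T. of_bool (t \<in> A) - of_bool (t \<in> A') = (0::real)"
      by (simp add: sum_subtractf count')
    then have "\<forall>t\<in>T. t \<in> A \<longleftrightarrow> t \<in> A'" by (auto simp: of_bool_def split: if_splits)
    then have "t \<in> A \<longleftrightarrow> t \<in> A'" for t
      using periodic_rep[OF per, of t] periodic_rep[OF per', of t] rep_T by metis
    then show False using not_closed jump jump' disjoint by blast
  qed
  have cover: "- A \<inter> - A' = {}"
  proof (rule ccontr)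
    assume "- A \<inter> - A' \<noteq> {}"
    then have "- A \<inter> - A' = UNIV"
    proof (rule S_closed_eq_UNIV)
      fix t s assume "t \<in> - A \<inter> - A'" "s \<in> S"
      then show "t + s \<in> - A \<inter> - A'" using near1 near2 jump jump' \<open>0 \<in> A'\<close> by blast
    qed
    then show False using \<open>g \<in> A\<close> by blast
  qed
  have nonneg: "of_bool (t \<in> A) + of_bool (t \<in> A') - (1::real) \<ge> 0" for t
    using cover by (auto simp: of_bool_def)
  have total: "(\<Sum>t\<in>T. of_bool (t \<in> A) + of_bool (t \<in> A') - (1::real))
      = 2 * (\<Sum>t\<in>T. of_bool (t \<in> A)) - real (card T)"
    by (simp add: sum_subtractf sum.distrib count')
  \<comment> \<open>Equality would make \<open>A'\<close> the complement of \<open>A\<close>, so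
    both would jump along the same edges; this gives the strict inequality.\<close>
  have "(\<Sum>t\<in>T. of_bool (t \<in> A) + of_bool (t \<in> A') - (1::real)) \<noteq> 0"
  proof
    assume "(\<Sum>t\<in>T. of_bool (t \<in> A) + of_bool (t \<in> A') - (1::real)) = 0"
    then have "\<forall>t\<in>T. of_bool (t \<in> A) + of_bool (t \<in> A') - (1::real) = 0"
      by (subst (asm) sum_nonneg_eq_0_iff[OF finite_T nonneg])
    then have "\<forall>t\<in>T. t \<in> A \<longleftrightarrow> t \<notin> A'" by (auto simp: of_bool_def split: if_splits)
    then have "t \<in> A \<longleftrightarrow> t \<notin> A'" for t
      using periodic_rep[OF per, of t] periodic_rep[OF per', of t] rep_T by metis
    then show False using not_closed jump jump' disjoint by blast
  qed
  moreover have "(\<Sum>t\<in>T. of_bool (t \<in> A) + of_bool (t \<in> A') - (1::real)) \<ge> 0"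
    by (intro sum_nonneg nonneg)
  ultimately show ?thesis unfolding total by simp
qed

text \<open>Otherwise \<open>A\<close> and its complement would both contain more than half of the
  classes.\<close>

lemma far_level_constant:
  assumes per: "periodic H (\<lambda>t. t \<in> A)"
    and jump: "\<And>t s. \<not> near r t \<Longrightarrow> s \<in> S \<Longrightarrow> t + s \<in> A \<longleftrightarrow> t \<in> A"
    and far: "far r g" "far r g'" and "g \<in> A"
  shows "g' \<in> A"
proof (rule ccontr)
  assume "g' \<notin> A"
  have "2 * (\<Sum>t\<in>T. of_bool (t \<in> A)) > real (card T)"
    using far_level_majority[OF per jump far(1) \<open>g \<in> A\<close>] \<open>g' \<notin> A\<close> by blast
  moreover have "2 * (\<Sum>t\<in>T. of_bool (t \<in> - A)) > real (card T)"
    using per jump by (intro far_level_majority[OF _ _ far(2)]) (use \<open>g \<in> A\<close> \<open>g' \<notin> A\<close> in \<open>auto simp: periodic_def\<close>)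
  moreover have "(\<Sum>t\<in>T. of_bool (t \<in> - A) :: real) = real (card T) - (\<Sum>t\<in>T. of_bool (t \<in> A))"
    by (simp add: of_bool_not_iff sum_subtractf)
  ultimately show False by simp
qed

lemma constant_on_far:
  fixes v :: "'g \<Rightarrow> int"
  assumes v: "periodic H v"
    and jump: "\<And>t s. \<not> near r t \<Longrightarrow> s \<in> S \<Longrightarrow> v (t + s) = v t"
  obtains c where "\<And>g. far r g \<Longrightarrow> v g = c"
proof -
  \<comment> \<open>The superlevel set of \<open>v\<close> at height \<open>v a\<close> contains the
    far point \<open>a\<close>, hence every far point.\<close>
  have le: "v a \<le> v b" if "far r a" "far r b" for a b
    using far_level_constant[of "{t. v a \<le> v t}" r a b] v jump that by (simp add: periodic_def)
  show ?thesis
  proof (cases "\<exists>g0. far r g0")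
    case True
    then obtain g0 where "far r g0" by blast
    then show ?thesis using that[of "v g0"] le by (meson order_antisym)
  next
    case False
    then show ?thesis using that by blast
  qed
qed

end

section \<open>Lifting potentials from the quotient to the group\<close>

context balanced
begin

text \<open>Summation by parts against an arbitrary \<open>x\<close>; since \<open>S\<close> is
  symmetric, \<open>Q\<close> contains the whole support of \<open>L u\<close>.\<close>

lemma sum_laplace_finite_support:
  assumes "finite D" "\<And>t. t \<notin> D \<Longrightarrow> u t = 0" "finite Q" "(\<lambda>(t, s). t + s) ` (D \<times> S) \<subseteq> Q"
  shows "(\<Sum>t\<in>Q. L u t * x t) = (\<Sum>t\<in>D. u t * L x t)"
proof -
  have shift: "(\<Sum>t\<in>Q. u (t + s) * x t) = (\<Sum>t\<in>D. u t * x (t + - s))" if "s \<in> S" for s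
  proof -
    have "D \<subseteq> (\<lambda>t. t + s) ` Q"
    proof
      fix t assume "t \<in> D"
      then have "t + - s \<in> Q" using S_uminus[OF that] assms(4) by force
      then show "t \<in> (\<lambda>t. t + s) ` Q" by (intro image_eqI[of _ _ "t + - s"]) (auto simp: add.assoc)
    qed
    then have "(\<Sum>t\<in>D. u t * x (t + - s)) = (\<Sum>t\<in>(\<lambda>t. t + s) ` Q. u t * x (t + - s))"
      using assms by (intro sum.mono_neutral_left) auto
    also have "\<dots> = (\<Sum>t\<in>Q. u (t + s) * x t)"
      by (subst sum.reindex) (auto simp: inj_on_def add.assoc)
    finally show ?thesis by simp
  qed
  have "(\<Sum>t\<in>Q. L u t * x t) = (\<Sum>s\<in>S. of_int (f s) * (\<Sum>t\<in>Q. u (t + s) * x t))"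
    unfolding laplace_def sum_distrib_right sum_distrib_left
    by (subst sum.swap) (simp add: ac_simps)
  also have "\<dots> = (\<Sum>s\<in>S. of_int (f (- s)) * (\<Sum>t\<in>D. u t * x (t + - s)))"
    by (simp only: shift f_uminus cong: sum.cong)
  also have "\<dots> = (\<Sum>s\<in>S. of_int (f s) * (\<Sum>t\<in>D. u t * x (t + s)))"
    by (rule sum.reindex_bij_witness[of _ uminus uminus]) (auto simp: S_uminus)
  also have "\<dots> = (\<Sum>t\<in>D. u t * L x t)"
    unfolding laplace_def sum_distrib_right sum_distrib_left
    by (subst sum.swap) (simp add: ac_simps)
  finally show ?thesis .
qed

text \<open>\<open>F\<close> is chosen before \<open>H\<close>. Up to a constant, the integral
  potential on the quotient lives on the classes of a fixed finite set; once \<open>H\<close> avoids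
  \<open>F\<close>, that set and its neighbourhood embed into the quotient and the potential
  lifts.\<close>

lemma periodic_annihilator_annihilates:
  fixes h :: "'g \<Rightarrow> int"
  assumes "finite K"
  obtains F where "finite F"
    "\<And>H x. is_normal_subgroup H \<Longrightarrow> finite_index H \<Longrightarrow> H \<inter> F \<subseteq> {0} \<Longrightarrow>
      (\<And>x. periodic H x \<Longrightarrow> (\<And>t. L x t \<in> \<int>) \<Longrightarrow> (\<Sum>k\<in>K. of_int (h k) * x k) \<in> \<int>) \<Longrightarrow>
      (\<And>t. L x t \<in> \<int>) \<Longrightarrow> (\<Sum>k\<in>K. of_int (h k) * x k) \<in> \<int>"
proof (cases "K = {}")
  case True
  then show ?thesis using that[of "{}"] by simp
next
  case False
  obtain d where d: "K \<subseteq> word_ball S d" using finite_subset_word_ball[OF assms] by blast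
  \<comment> \<open>The oscillation bound rounded up to an integer. With it,
    \<open>jump_near\<close> applies at every point with \<open>n = C\<close> and confines the jumps
    to radius \<open>r\<close>.\<close>
  define C where "C = nat \<lceil>8 * (real d)\<^sup>2 * (\<Sum>k\<in>K. \<bar>real_of_int (h k)\<bar>)\<rceil>"
  define r where "r = d + C"
  \<comment> \<open>Points whose class avoids \<open>D\<close> are \<open>far\<close>.
    \<open>Q\<close> contains \<open>K\<close> and the support of the Laplacian of any function
    living on \<open>D\<close>; \<open>Q'\<close> adds the neighbours that the Laplacian on
    \<open>Q\<close> reads.\<close>
  define D where "D = (\<lambda>(a, b). a - b) ` (word_ball S r \<times> word_ball S r)"
  define plus_S where "plus_S X = (\<lambda>(t, s). t + s) ` (X \<times> S)" for X :: "'g set"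
  define Q where "Q = K \<union> D \<union> plus_S D"
  define Q' where "Q' = Q \<union> plus_S Q"
  define F where "F = (\<lambda>(a, b). - a + b) ` (Q' \<times> Q')"
  have fin: "finite D" "finite Q" "finite Q'" "finite F"
    using assms finite_S finite_word_ball[OF finite_S]
    by (auto simp: D_def Q_def Q'_def F_def plus_S_def)
  show ?thesis
  proof (rule that[OF fin(4)])
    fix H x
    assume H: "is_normal_subgroup H" "finite_index H" "H \<inter> F \<subseteq> {0}"
      and annih: "\<And>x. periodic H x \<Longrightarrow> (\<And>t. L x t \<in> \<int>) \<Longrightarrow> (\<Sum>k\<in>K. of_int (h k) * x k) \<in> \<int>"
      and x: "\<And>t. L x t \<in> \<int>"
    have "is_subgroup H" using H(1) by (simp add: is_normal_subgroup_def)
    from finite_index_transversal[OF this H(2)]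
    obtain T where T: "finite T" "\<forall>t. \<exists>!r. r \<in> T \<and> - r + t \<in> H"
      by (elim exE conjE)
    interpret balanced_quotient f H T
      by unfold_locales (use H(1) T in \<open>simp_all only: simp_thms\<close>)
    have inj: "a = b" if "a \<in> Q'" "b \<in> Q'" "- a + b \<in> H" for a b
    proof -
      have "- a + b \<in> F" using that by (force simp: F_def)
      then have "- a + b = 0" using that H(3) by blast
      then show ?thesis by (metis add.inverse_inverse neg_eq_iff_add_eq_0 add_eq_0_iff)
    qed
    obtain v where v: "periodic H v" "\<And>t. L (\<lambda>t. of_int (v t)) t = periodization K h t"
      using integral_potential[OF annih] by blast
    have v': "periodic H (\<lambda>t. real_of_int (v t))" using v(1) by (simp add: periodic_def)
    obtain k where k: "\<And>t. v t \<le> v k"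
      using potential_attains_max[OF v' v(2)] False by (metis all_not_in_conv of_int_le_iff)
    have osc: "v t + int C \<ge> v k" for t
      using potential_oscillation[OF v' v(2) assms d False, of k t] unfolding C_def by linarith
    have "v (t + s) = v t" if "\<not> near r t" "s \<in> S" for t s
      using jump_near[OF v d k osc \<open>s \<in> S\<close>] that unfolding r_def by blast
    then obtain c where c: "\<And>g. far r g \<Longrightarrow> v g = c"
      using constant_on_far[OF v(1)] by blast
    \<comment> \<open>Subtracting the far value \<open>c\<close> and cutting off outside
      \<open>D\<close> gives finite support. On all neighbours of \<open>Q\<close> this still agrees
      with \<open>v - c\<close>, so the Laplacians agree on \<open>Q\<close>.\<close>
    define u where "u t = (if t \<in> D then real_of_int (v t - c) else 0)" for t
    have u: "u (t + s) = v (t + s) - c" if "t \<in> Q" "s \<in> S" for t s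
    proof (cases "t + s \<in> D")
      case notD: False
      have "t + s \<in> Q'" using that by (force simp: Q'_def plus_S_def)
      then have "- e + (t + s) \<notin> H" if "e \<in> D" for e
        using inj[of e "t + s"] notD that by (auto simp: Q'_def Q_def)
      then have "far r (t + s)" by (force simp: far_def D_def)
      with notD c show ?thesis by (simp add: u_def)
    qed (simp add: u_def)
    have Lu: "L u t = (if t \<in> K then of_int (h t) else 0)" if "t \<in> Q" for t
    proof -
      have "L u t = L (\<lambda>t. of_int (v t) + - of_int c) t"
        unfolding laplace_def using u[OF that] by (intro sum.cong) auto
      also have "\<dots> = periodization K h t"
        unfolding laplace_add by (simp add: v(2))
      also have "\<dots> = (\<Sum>k\<in>K. if k = t then of_int (h t) else 0)"
        unfolding periodization_def
      proof (rule sum.cong)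
        fix k assume "k \<in> K"
        then have "- t + k \<in> H \<longleftrightarrow> k = t"
          using inj[of t k] that zero_H by (auto simp: Q_def Q'_def)
        then show "of_int (h k) * delta k t = (if k = t then of_int (h t) else 0)"
          by (simp add: delta_def)
      qed simp
      finally show ?thesis using assms by simp
    qed
    have "(\<Sum>k\<in>K. of_int (h k) * x k) = (\<Sum>t\<in>Q. L u t * x t)"
      using fin(2) by (intro sum.mono_neutral_cong_left) (auto simp: Lu Q_def)
    also have "\<dots> = (\<Sum>t\<in>D. u t * L x t)"
      by (rule sum_laplace_finite_support) (use fin in \<open>auto simp: u_def Q_def plus_S_def\<close>)
    also have "\<dots> \<in> \<int>" using x by (intro Ints_sum Ints_mult) (auto simp: u_def)
    finally show "(\<Sum>k\<in>K. of_int (h k) * x k) \<in> \<int>" .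
  qed
qed

end

section \<open>Duality in finite-dimensional tori\<close>

text \<open>Strict convexity of the disc; it makes the averaging factor of a nontrivial character
  value decay.\<close>

lemma norm_half_one_plus_less_1:
  fixes z :: complex
  assumes "norm z = 1" "z \<noteq> 1"
  shows "norm ((1 + z) / 2) < 1"
proof -
  have sq: "(Re z)\<^sup>2 + (Im z)\<^sup>2 = 1" using assms(1) cmod_power2[of z] by simp
  have "Re z \<noteq> 1" using assms(2) sq by (auto simp: complex_eq_iff)
  moreover have "Re z \<le> 1" using complex_Re_le_cmod[of z] assms(1) by simp
  ultimately have "Re z < 1" by simp
  have "(norm (1 + z))\<^sup>2 = 2 + 2 * Re z"
    unfolding cmod_power2 using sq by (simp add: power2_eq_square algebra_simps)
  then have "(norm (1 + z))\<^sup>2 < 2\<^sup>2" using \<open>Re z < 1\<close> by simp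
  then have "norm (1 + z) < 2" by (rule power2_less_imp_less) simp
  then show ?thesis by (simp add: norm_divide)
qed

text \<open>Averaging repeatedly with the translate by a point where some character is nontrivial kills
  that character in the limit and preserves the bound; this replaces integration against Haar
  measure.\<close>

lemma trivial_coefficient_bound:
  fixes \<psi> :: "'i \<Rightarrow> 'y \<Rightarrow> complex"
  assumes "finite I" "Y \<noteq> {}"
    and mult: "\<And>y z. y \<in> Y \<Longrightarrow> z \<in> Y \<Longrightarrow> m y z \<in> Y"
    and hom: "\<And>i y z. y \<in> Y \<Longrightarrow> z \<in> Y \<Longrightarrow> \<psi> i (m y z) = \<psi> i y * \<psi> i z"
    and unit: "\<And>i y. y \<in> Y \<Longrightarrow> norm (\<psi> i y) = 1"
    and nontrivial: "\<And>i. i \<in> I \<Longrightarrow> \<exists>y\<in>Y. \<psi> i y \<noteq> 1"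
    and bound: "\<And>y. y \<in> Y \<Longrightarrow> norm (a0 + (\<Sum>i\<in>I. a i * \<psi> i y)) \<le> B"
  shows "norm a0 \<le> B"
  using assms(1) nontrivial bound
proof (induction I rule: finite_psubset_induct)
  case (psubset I)
  show ?case
  proof (cases "I = {}")
    case True
    then show ?thesis using psubset.prems(2) \<open>Y \<noteq> {}\<close> by auto
  next
    case False
    then obtain i0 y0 where i0: "i0 \<in> I" "y0 \<in> Y" "\<psi> i0 y0 \<noteq> 1" using psubset.prems(1) by blast
    \<comment> \<open>Averaging with the translate by \<open>y0\<close> multiplies the coefficient
      of \<open>\<psi> i\<close> by \<open>c i\<close>, which is \<open>1\<close> on
      \<open>I'\<close> and has modulus below one elsewhere. The limit of the iteration keeps only
      \<open>I'\<close>, which has lost \<open>i0\<close>.\<close>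
    define c where "c i = (1 + \<psi> i y0) / 2" for i
    define I' where "I' = {i \<in> I. \<psi> i y0 = 1}"
    have I': "I' \<subset> I" using i0 by (auto simp: I'_def)
    have avg: "norm (a0 + (\<Sum>i\<in>I. a i * c i ^ n * \<psi> i y)) \<le> B" if "y \<in> Y" for n y
      using that
    proof (induction n arbitrary: y)
      case 0
      then show ?case using psubset.prems(2) by simp
    next
      case (Suc n)
      let ?\<phi> = "\<lambda>y. a0 + (\<Sum>i\<in>I. a i * c i ^ n * \<psi> i y)"
      have "a0 + (\<Sum>i\<in>I. a i * c i ^ Suc n * \<psi> i y) = (?\<phi> y + ?\<phi> (m y y0)) / 2"
      proof -
        have "a0 + (\<Sum>i\<in>I. a i * c i ^ Suc n * \<psi> i y)
            = (a0 + a0) / 2 + ((\<Sum>i\<in>I. a i * c i ^ n * \<psi> i y) + (\<Sum>i\<in>I. a i * c i ^ n * \<psi> i (m y y0))) / 2"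
          unfolding sum.distrib[symmetric] sum_divide_distrib hom[OF Suc.prems i0(2)]
          by (simp add: c_def[of i for i] algebra_simps add_divide_distrib)
        then show ?thesis by (simp add: field_simps)
      qed
      also have "norm \<dots> \<le> (norm (?\<phi> y) + norm (?\<phi> (m y y0))) / 2"
        using norm_triangle_ineq[of "?\<phi> y" "?\<phi> (m y y0)"] by (simp add: norm_divide)
      also have "\<dots> \<le> (B + B) / 2"
        using Suc.IH[OF Suc.prems] Suc.IH[OF mult[OF Suc.prems i0(2)]]
        by (intro divide_right_mono add_mono) auto
      finally show ?case by simp
    qed
    have lim: "(\<lambda>n. c i ^ n) \<longlonglongrightarrow> (if \<psi> i y0 = 1 then 1 else 0)" for i
    proof (cases "\<psi> i y0 = 1")
      case True
      then show ?thesis by (simp add: c_def)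
    next
      case False
      then have "norm (c i) < 1" unfolding c_def by (intro norm_half_one_plus_less_1 unit i0)
      then show ?thesis using False by (simp add: LIMSEQ_power_zero)
    qed
    show ?thesis
    proof (rule psubset.IH[OF I'])
      show "\<exists>y\<in>Y. \<psi> i y \<noteq> 1" if "i \<in> I'" for i using that psubset.prems(1) by (auto simp: I'_def)
      fix y assume "y \<in> Y"
      have "(\<lambda>n. norm (a0 + (\<Sum>i\<in>I. a i * c i ^ n * \<psi> i y)))
          \<longlonglongrightarrow> norm (a0 + (\<Sum>i\<in>I. a i * (if \<psi> i y0 = 1 then 1 else 0) * \<psi> i y))"
        by (intro tendsto_intros lim)
      then have "norm (a0 + (\<Sum>i\<in>I. a i * (if \<psi> i y0 = 1 then 1 else 0) * \<psi> i y)) \<le> B"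
        using avg[OF \<open>y \<in> Y\<close>] by (intro LIMSEQ_le_const2) auto
      also have "(\<Sum>i\<in>I. a i * (if \<psi> i y0 = 1 then 1 else 0) * \<psi> i y) = (\<Sum>i\<in>I'. a i * \<psi> i y)"
        unfolding I'_def using psubset.hyps by (subst sum.inter_filter) (auto intro!: sum.cong)
      finally show "norm (a0 + (\<Sum>i\<in>I'. a i * \<psi> i y)) \<le> B" .
    qed
  qed
qed

lemma power_times_geometric_tendsto_0:
  fixes l :: real
  assumes "0 < l" "l < 1"
  shows "(\<lambda>n. (2 * real n) ^ k * l ^ n) \<longlonglongrightarrow> 0"
proof -
  \<comment> \<open>A root of degree \<open>k + 1\<close> distributes the decay: \<open>k\<close>
    copies of \<open>\<mu> ^ n\<close> absorb the linear factors and one is left over.\<close>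
  define \<mu> where "\<mu> = root (Suc k) l"
  have \<mu>: "\<mu> ^ Suc k = l" "0 < \<mu>" using assms unfolding \<mu>_def by (intro real_root_pow_pos2, simp_all)
  have "\<mu> < 1"
  proof (rule ccontr)
    assume "\<not> \<mu> < 1"
    then have "1 \<le> \<mu> ^ Suc k" by (intro one_le_power) simp
    with \<mu>(1) assms show False by simp
  qed
  have "(\<lambda>n. (2 * (real n * \<mu> ^ n)) ^ k * \<mu> ^ n) \<longlonglongrightarrow> (2 * 0) ^ k * 0"
    using \<mu>(2) \<open>\<mu> < 1\<close> by (intro tendsto_intros powser_times_n_limit_0 LIMSEQ_power_zero) auto
  moreover have "(2 * (real n * \<mu> ^ n)) ^ k * \<mu> ^ n = (2 * real n) ^ k * l ^ n" for n
  proof -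
    have "l ^ n = (\<mu> ^ n) ^ k * \<mu> ^ n"
      unfolding \<mu>(1)[symmetric] by (simp add: power_mult[symmetric] power_add[symmetric] algebra_simps)
    then show ?thesis by (simp add: power_mult_distrib)
  qed
  ultimately show ?thesis by (simp only: mult_zero_right)
qed

text \<open>On the unit circle \<open>2 + 2 * Re z\<close> equals
  \<open>(1 + z)\<^sup>2 / z\<close>, so this is the binomial theorem divided by
  \<open>z ^ N\<close>; the constant term sits at \<open>m = N\<close>.\<close>

lemma circle_kernel_expansion:
  fixes z :: complex
  assumes "norm z = 1"
  shows "complex_of_real (((2 + 2 * Re z) / 4) ^ N)
    = (\<Sum>m\<le>2*N. complex_of_real (real ((2 * N) choose m) / 4 ^ N) * z powi (int m - int N))"
proof -
  have "z \<noteq> 0" using assms by auto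
  have "z * cnj z = 1" using assms by (simp add: complex_norm_square[symmetric])
  then have "(1 + z)\<^sup>2 = z * (2 + (z + cnj z))" by (simp add: power2_eq_square algebra_simps)
  also have "z + cnj z = of_real (2 * Re z)" by (simp add: complex_add_cnj)
  finally have sq: "(1 + z)\<^sup>2 = z * of_real (2 + 2 * Re z)" by simp
  have "(1 + z) ^ (2 * N) = z ^ N * of_real (2 + 2 * Re z) ^ N"
    unfolding power_mult sq power_mult_distrib ..
  then have "of_real (2 + 2 * Re z) ^ N = (1 + z) ^ (2 * N) / z ^ N" using \<open>z \<noteq> 0\<close> by simp
  also have "(1 + z) ^ (2 * N) = (\<Sum>m\<le>2*N. of_nat ((2 * N) choose m) * z ^ m)"
    using binomial_ring[of z 1 "2 * N"] by (simp add: add.commute)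
  also have "\<dots> / z ^ N = (\<Sum>m\<le>2*N. of_nat ((2 * N) choose m) * z powi (int m - int N))"
    using \<open>z \<noteq> 0\<close> by (simp add: sum_divide_distrib power_int_diff)
  finally show ?thesis
    by (simp add: power_divide sum_divide_distrib mult.commute divide_simps)
qed

text \<open>A quantitative form of duality for subgroups of a finite-dimensional torus: the characters
  with exponents bounded by \<open>N\<close> suffice, and \<open>N\<close> does not depend on the subgroup. The trigonometric
  kernel below decays exponentially in \<open>N\<close> away from \<open>1\<close>, while its constant coefficient, a power of
  a central binomial coefficient over \<open>4^N\<close>, decays only polynomially.\<close>

lemma uniform_torus_duality:
  fixes W :: "'g set" and \<epsilon> :: real
  assumes "finite W" "\<epsilon> > 0"
  obtains N :: nat where
    "\<And>(Y :: ('g \<Rightarrow> complex) set) p.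
      (\<lambda>_. 1) \<in> Y \<Longrightarrow>
      (\<And>y z. y \<in> Y \<Longrightarrow> z \<in> Y \<Longrightarrow> (\<lambda>t. y t * z t) \<in> Y) \<Longrightarrow>
      (\<And>y. y \<in> Y \<Longrightarrow> (\<lambda>t. inverse (y t)) \<in> Y) \<Longrightarrow>
      (\<And>y t. y \<in> Y \<Longrightarrow> norm (y t) = 1) \<Longrightarrow>
      (\<And>t. norm (p t) = 1) \<Longrightarrow>
      (\<And>h. (\<And>w. \<bar>h w\<bar> \<le> int N) \<Longrightarrow> (\<And>y. y \<in> Y \<Longrightarrow> (\<Prod>w\<in>W. y w powi h w) = 1) \<Longrightarrow>
        (\<Prod>w\<in>W. p w powi h w) = 1) \<Longrightarrow>
      \<exists>y\<in>Y. \<forall>w\<in>W. dist (p w) (y w) < \<epsilon>"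
proof -
  define \<delta> where "\<delta> = min \<epsilon> 1"
  have \<delta>: "0 < \<delta>" "\<delta> \<le> 1" "\<delta> \<le> \<epsilon>" using assms(2) by (auto simp: \<delta>_def)
  \<comment> \<open>On the unit circle
    \<open>(2 + 2 * Re z) / 4 = 1 - (norm (z - 1))\<^sup>2 / 4\<close>, which is at most
    \<open>l\<close> at distance \<open>\<delta>\<close> or more from \<open>1\<close>. Capping
    \<open>\<delta>\<close> at \<open>1\<close> keeps \<open>l\<close> positive.\<close>
  define l where "l = 1 - \<delta>\<^sup>2 / 4"
  have "\<delta>\<^sup>2 \<le> 1" using \<delta> by (simp add: power_le_one)
  then have l: "0 < l" "l < 1" using \<delta>(1) by (auto simp: l_def)
  have "\<forall>\<^sub>F n in sequentially. (2 * real n) ^ card W * l ^ n < 1"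
    by (rule order_tendstoD[OF power_times_geometric_tendsto_0[OF l]]) simp
  then obtain N0 where N0: "\<And>n. n \<ge> N0 \<Longrightarrow> (2 * real n) ^ card W * l ^ n < 1"
    by (auto simp: eventually_sequentially)
  define N where "N = Suc N0"
  have N: "N > 0" "(2 * real N) ^ card W * l ^ N < 1" using N0[of N] by (auto simp: N_def)
  show ?thesis
  proof (rule that[of N], rule ccontr)
    fix Y :: "('g \<Rightarrow> complex) set" and p :: "'g \<Rightarrow> complex"
    assume one: "(\<lambda>_. 1) \<in> Y"
      and mult: "\<And>y z. y \<in> Y \<Longrightarrow> z \<in> Y \<Longrightarrow> (\<lambda>t. y t * z t) \<in> Y"
      and inv: "\<And>y. y \<in> Y \<Longrightarrow> (\<lambda>t. inverse (y t)) \<in> Y"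
      and unit: "\<And>y t. y \<in> Y \<Longrightarrow> norm (y t) = 1" and p: "\<And>t. norm (p t) = 1"
      and dual: "\<And>h. (\<And>w. \<bar>h w\<bar> \<le> int N) \<Longrightarrow> (\<And>y. y \<in> Y \<Longrightarrow> (\<Prod>w\<in>W. y w powi h w) = 1) \<Longrightarrow>
        (\<Prod>w\<in>W. p w powi h w) = 1"
      and away: "\<not> (\<exists>y\<in>Y. \<forall>w\<in>W. dist (p w) (y w) < \<epsilon>)"
    define \<psi> where "\<psi> e y = (\<Prod>w\<in>W. y w powi (int (e w) - int N))" for e :: "'g \<Rightarrow> nat" and y :: "'g \<Rightarrow> complex"
    define c where "c e = (\<Prod>w\<in>W. real ((2 * N) choose (e w)) / 4 ^ N)" for e :: "'g \<Rightarrow> nat"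
    define E where "E = PiE W (\<lambda>_. {..2 * N})"
    define P where "P y = (\<Prod>w\<in>W. ((2 + 2 * Re (p w * y w)) / 4) ^ N)" for y :: "'g \<Rightarrow> complex"
    \<comment> \<open>The characters of the expansion that are trivial on \<open>Y\<close>. By
      \<open>dual\<close> they are trivial at \<open>p\<close> as well, so they contribute the
      constant sum of their coefficients \<open>c e\<close>, to which
      \<open>trivial_coefficient_bound\<close> applies.\<close>
    define E0 where "E0 = {e \<in> E. \<forall>y\<in>Y. \<psi> e y = 1}"
    have finE: "finite E" using assms(1) by (simp add: E_def finite_PiE)
    have c_nonneg: "c e \<ge> 0" for e unfolding c_def by (intro prod_nonneg) simp
    have expand: "complex_of_real (P y) = (\<Sum>e\<in>E. of_real (c e) * \<psi> e p * \<psi> e y)" if "y \<in> Y" for y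
    proof -
      have "complex_of_real (P y) = (\<Prod>w\<in>W. \<Sum>m\<le>2*N. complex_of_real (real ((2 * N) choose m) / 4 ^ N)
          * (p w * y w) powi (int m - int N))"
        unfolding P_def of_real_prod using that
        by (intro prod.cong circle_kernel_expansion) (simp_all add: norm_mult p unit)
      also have "\<dots> = (\<Sum>e\<in>E. \<Prod>w\<in>W. complex_of_real (real ((2 * N) choose (e w)) / 4 ^ N)
          * (p w * y w) powi (int (e w) - int N))"
        unfolding E_def by (rule prod_sum_PiE) (simp_all add: assms(1))
      also have "\<dots> = (\<Sum>e\<in>E. of_real (c e) * \<psi> e p * \<psi> e y)"
        unfolding c_def \<psi>_def of_real_prod prod.distrib[symmetric]
        by (simp add: power_int_mult_distrib mult.assoc)
      finally show ?thesis .
    qed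
    have bound: "norm (complex_of_real (P y)) \<le> l ^ N" if y: "y \<in> Y" for y
    proof -
      \<comment> \<open>The factors of \<open>P y\<close> measure how close \<open>p\<close> is to
        the pointwise inverse of \<open>y\<close>, so \<open>away\<close> is applied to that
        inverse.\<close>
      have "\<exists>w\<in>W. \<epsilon> \<le> dist (p w) (inverse (y w))" using away inv[OF y] by force
      then obtain w where w: "w \<in> W" "\<epsilon> \<le> dist (p w) (inverse (y w))" by blast
      define z where "z v = p v * y v" for v
      have z: "norm (z v) = 1" for v using p unit[OF y] by (simp add: z_def norm_mult)
      have Re_z: "0 \<le> (2 + 2 * Re (z v)) / 4" "(2 + 2 * Re (z v)) / 4 \<le> 1" for v
        using complex_Re_le_cmod[of "z v"] abs_Re_le_cmod[of "z v"] z[of v] by auto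
      have "y w \<noteq> 0" using unit[OF y, of w] by auto
      then have "dist (p w) (inverse (y w)) = norm (z w - 1) * norm (inverse (y w))"
        unfolding norm_mult[symmetric] dist_norm by (simp add: z_def algebra_simps)
      then have "\<delta> \<le> norm (z w - 1)" using w(2) \<delta>(3) unit[OF y, of w] by (simp add: norm_inverse)
      then have "\<delta>\<^sup>2 \<le> (norm (z w - 1))\<^sup>2" using \<delta>(1) by (intro power_mono) auto
      also have "\<dots> = 2 - 2 * Re (z w)"
        using z[of w] cmod_power2[of "z w"] unfolding cmod_power2[of "z w - 1"]
        by (simp add: power2_eq_square algebra_simps)
      finally have "(2 + 2 * Re (z w)) / 4 \<le> l" by (simp add: l_def field_simps)
      then have "((2 + 2 * Re (z w)) / 4) ^ N \<le> l ^ N" using Re_z by (intro power_mono) auto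
      moreover have "(\<Prod>v\<in>W - {w}. ((2 + 2 * Re (z v)) / 4) ^ N) \<le> 1"
        using Re_z by (intro prod_le_1) (auto simp: power_le_one)
      moreover have "0 \<le> (\<Prod>v\<in>W - {w}. ((2 + 2 * Re (z v)) / 4) ^ N)"
        using Re_z by (intro prod_nonneg) auto
      ultimately have "((2 + 2 * Re (z w)) / 4) ^ N * (\<Prod>v\<in>W - {w}. ((2 + 2 * Re (z v)) / 4) ^ N) \<le> l ^ N * 1"
        using l by (intro mult_mono) auto
      then have "P y \<le> l ^ N" using w(1) assms(1) by (simp add: P_def z_def prod.remove)
      moreover have "0 \<le> P y" unfolding P_def z_def[symmetric] using Re_z by (intro prod_nonneg) auto
      ultimately show ?thesis by simp
    qed
    have trivial_p: "\<psi> e p = 1" if "e \<in> E0" for e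
    proof -
      define h where "h w = (if w \<in> W then int (e w) - int N else 0)" for w
      have eq: "\<psi> e y = (\<Prod>w\<in>W. y w powi h w)" for y
        unfolding \<psi>_def h_def by (rule prod.cong) auto
      have "\<bar>h w\<bar> \<le> int N" for w using that by (auto simp: h_def E0_def E_def dest!: PiE_mem)
      then show ?thesis unfolding eq using that by (intro dual) (auto simp: E0_def eq)
    qed
    have "norm (complex_of_real (\<Sum>e\<in>E0. c e)) \<le> l ^ N"
    proof (rule trivial_coefficient_bound[where I = "E - E0" and Y = Y and \<psi> = \<psi> and
          m = "\<lambda>y z t. y t * z t" and a = "\<lambda>e. of_real (c e) * \<psi> e p"])
      show "\<psi> e (\<lambda>t. y t * z t) = \<psi> e y * \<psi> e z" for e y z
        by (simp add: \<psi>_def power_int_mult_distrib prod.distrib)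
      show "norm (\<psi> e y) = 1" if "y \<in> Y" for e y
        using unit[OF that] by (simp add: \<psi>_def prod_norm[symmetric] norm_power_int)
      show "\<exists>y\<in>Y. \<psi> e y \<noteq> 1" if "e \<in> E - E0" for e using that by (auto simp: E0_def)
      fix y assume y: "y \<in> Y"
      have "(\<Sum>e\<in>E. of_real (c e) * \<psi> e p * \<psi> e y)
          = (\<Sum>e\<in>E - E0. of_real (c e) * \<psi> e p * \<psi> e y) + (\<Sum>e\<in>E0. of_real (c e) * \<psi> e p * \<psi> e y)"
        by (rule sum.subset_diff) (auto simp: E0_def finE)
      also have "(\<Sum>e\<in>E0. of_real (c e) * \<psi> e p * \<psi> e y) = complex_of_real (\<Sum>e\<in>E0. c e)"
        unfolding of_real_sum using y by (intro sum.cong) (auto simp: trivial_p, auto simp: E0_def)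
      finally show "norm (complex_of_real (\<Sum>e\<in>E0. c e) + (\<Sum>e\<in>E - E0. of_real (c e) * \<psi> e p * \<psi> e y)) \<le> l ^ N"
        using bound[OF y] unfolding expand[OF y] by (simp add: add.commute)
    qed (use finE one mult in auto)
    then have small: "(\<Sum>e\<in>E0. c e) \<le> l ^ N" by (metis abs_ge_self norm_of_real order_trans)
    \<comment> \<open>The index with all exponents zero. Its value off \<open>W\<close> is
      \<open>undefined\<close> because members of \<open>PiE\<close> are extensional.\<close>
    define e0 where "e0 = (\<lambda>w. if w \<in> W then N else undefined)"
    have "e0 \<in> E0" by (auto simp: E0_def E_def e0_def \<psi>_def)
    then have "c e0 \<le> (\<Sum>e\<in>E0. c e)"
      using finE c_nonneg by (intro member_le_sum) (auto simp: E0_def)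
    moreover have "c e0 \<ge> (1 / (2 * real N)) ^ card W"
    proof -
      have "4 ^ N / (2 * real N) \<le> real ((2 * N) choose N)"
        by (rule central_binomial_lower_bound[OF N(1)])
      then have "1 / (2 * real N) \<le> real ((2 * N) choose N) / 4 ^ N" by (simp add: field_simps)
      moreover have "c e0 = (real ((2 * N) choose N) / 4 ^ N) ^ card W" by (simp add: c_def e0_def)
      ultimately show ?thesis by (simp only:) (rule power_mono, simp_all)
    qed
    ultimately have "(1 / (2 * real N)) ^ card W \<le> l ^ N" using small by linarith
    then have "1 \<le> (2 * real N) ^ card W * l ^ N" using N(1) by (simp add: field_simps)
    with N(2) show False by simp
  qed
qed

section \<open>The harmonic model\<close>

lemma norm_circ [simp]: "norm (circ t) = 1"
  by (simp add: circ_def)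

lemma circ_add: "circ (a + b) = circ a * circ b"
  by (simp add: circ_def cis_mult distrib_left)

lemma circ_sum: "circ (\<Sum>i\<in>A. x i) = (\<Prod>i\<in>A. circ (x i))"
proof (induction A rule: infinite_finite_induct)
  case (insert i A)
  then show ?case by (simp add: circ_add)
qed (simp_all add: circ_def)

lemma circ_mult_of_int: "circ (x * of_int k) = circ x powi k"
  by (simp add: circ_def cis_power_int mult_ac)

lemma circ_eq_1_iff: "circ t = 1 \<longleftrightarrow> t \<in> \<int>"
proof
  assume "circ t = 1"
  then have "cos (2 * pi * t) = 1" by (simp add: circ_def complex_eq_iff)
  then obtain n :: int where "2 * pi * t = n * 2 * pi" by (auto simp: cos_one_2pi_int)
  then have "t = of_int n" by simp
  then show "t \<in> \<int>" by simp
qed (simp add: circ_def)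

lemma norm_1_imp_circ:
  assumes "norm z = 1"
  shows "\<exists>t. z = circ t"
proof -
  have "z \<noteq> 0" using assms by auto
  then have "cis (Arg z) = z" using assms cis_Arg[of z] by (simp add: sgn_eq)
  then show ?thesis by (intro exI[of _ "Arg z / (2 * pi)"]) (simp add: circ_def)
qed

lemma prod_circ_powi: "(\<Prod>w\<in>W. circ (x w) powi h w) = circ (\<Sum>w\<in>W. of_int (h w) * x w)"
  by (simp add: circ_sum circ_mult_of_int mult.commute)

text \<open>The condition on a lift depends on it only modulo integers, hence is a multiplicative
  condition on the circle values. In this form closure under products and topological closedness are
  direct.\<close>

lemma X_f_iff:
  "y \<in> X_f f \<longleftrightarrow> (\<forall>t. norm (y t) = 1) \<and> (\<forall>t. (\<Prod>s\<in>supp f. y (t + s) powi f s) = 1)"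
proof -
  have eq: "(\<Prod>s\<in>supp f. circ (x (t + s)) powi f s) = circ (laplace f x t)" for x t
    by (simp add: laplace_def circ_sum circ_mult_of_int)
  show ?thesis
  proof
    assume "y \<in> X_f f"
    then show "(\<forall>t. norm (y t) = 1) \<and> (\<forall>t. (\<Prod>s\<in>supp f. y (t + s) powi f s) = 1)"
      unfolding X_f_def laplace_def[symmetric] by (auto simp: eq circ_eq_1_iff)
  next
    assume y: "(\<forall>t. norm (y t) = 1) \<and> (\<forall>t. (\<Prod>s\<in>supp f. y (t + s) powi f s) = 1)"
    then have "\<forall>t. \<exists>s. y t = circ s" using norm_1_imp_circ by blast
    from choice[OF this] obtain x where "\<forall>t. y t = circ (x t)" by blast
    then have "y = (\<lambda>t. circ (x t))" by (simp add: fun_eq_iff)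
    with y show "y \<in> X_f f"
      unfolding X_f_def laplace_def[symmetric] by (auto simp: eq circ_eq_1_iff)
  qed
qed

lemma compact_X_f: "compact (X_f f)"
proof -
  define K :: "('a \<Rightarrow> complex) set" where "K = (\<Pi>\<^sub>E t\<in>UNIV. sphere 0 1)"
  have memK: "y \<in> K \<longleftrightarrow> (\<forall>t. norm (y t) = 1)" for y by (auto simp: K_def PiE_iff)
  have "compactin (product_topology (\<lambda>_. euclidean) UNIV) K"
    unfolding K_def by (subst compactin_PiE) (simp add: compactin_euclidean_iff)
  then have "compact K" by (simp add: euclidean_product_topology compactin_euclidean_iff)
  have "closed K"
  proof -
    have "K = (\<Inter>t. {y. norm (y t) = 1})" by (auto simp: memK)
    then show ?thesis by (auto intro!: closed_Collect_eq continuous_intros)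
  qed
  \<comment> \<open>Closedness is shown inside \<open>K\<close>: for negative exponents
    \<open>powi\<close> is continuous only away from zero.\<close>
  have "closed {y \<in> K. (\<Prod>s\<in>supp f. y (t + s) powi f s) = 1}" for t
  proof (rule continuous_closed_preimage_constant[OF _ \<open>closed K\<close>])
    have "y r \<noteq> 0" if "y \<in> K" for y r using that by (auto simp: memK dest: spec[of _ r])
    then show "continuous_on K (\<lambda>y. \<Prod>s\<in>supp f. y (t + s) powi f s)"
      by (intro continuous_intros continuous_on_subset[OF continuous_on_product_coordinates]) auto
  qed
  then have "closed (\<Inter>t. {y \<in> K. (\<Prod>s\<in>supp f. y (t + s) powi f s) = 1})" by blast
  moreover have "X_f f = K \<inter> (\<Inter>t. {y \<in> K. (\<Prod>s\<in>supp f. y (t + s) powi f s) = 1})"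
    by (auto simp: X_f_iff memK)
  ultimately show ?thesis using \<open>compact K\<close> by (simp add: compact_Int_closed)
qed

lemma one_in_Fix: "(\<lambda>_. 1) \<in> Fix H (X_f f)"
  by (simp add: Fix_def X_f_iff shift_def)

lemma mult_in_Fix:
  "y \<in> Fix H (X_f f) \<Longrightarrow> z \<in> Fix H (X_f f) \<Longrightarrow> (\<lambda>t. y t * z t) \<in> Fix H (X_f f)"
  by (auto simp: Fix_def X_f_iff shift_def norm_mult power_int_mult_distrib prod.distrib fun_eq_iff)

lemma inverse_in_Fix: "y \<in> Fix H (X_f f) \<Longrightarrow> (\<lambda>t. inverse (y t)) \<in> Fix H (X_f f)"
  by (auto simp: Fix_def X_f_iff shift_def norm_inverse power_int_inverse prod_inversef[unfolded comp_def] fun_eq_iff)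

text \<open>Left translation of \<open>t\<close> by \<open>- s\<close> is right translation by the
  conjugate \<open>- t - s + t\<close>, which lies in \<open>H\<close> by normality.\<close>

lemma circ_periodic_in_Fix:
  assumes "is_normal_subgroup H" "periodic H x" "\<And>t. laplace f x t \<in> \<int>"
  shows "(\<lambda>t. circ (x t)) \<in> Fix H (X_f f)"
proof -
  have "x (- s + t) = x t" if "s \<in> H" for s t
  proof -
    have "- s \<in> H" using assms(1) that by (auto simp: is_normal_subgroup_def is_subgroup_def)
    then have "- t + - s - (- t) \<in> H" using assms(1) unfolding is_normal_subgroup_def by blast
    then have "x (t + (- t + - s - (- t))) = x t" using assms(2) unfolding periodic_def by blast
    then show ?thesis by (simp add: group_normalize del: add_uminus_conv_diff)
  qed
  then show ?thesis using assms(3) by (auto simp: Fix_def X_f_def shift_def laplace_def)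
qed

section \<open>Compatible metrics and Hausdorff distance\<close>

lemma open_fun_contains_cylinder:
  fixes U :: "('g \<Rightarrow> 'a::metric_space) set"
  assumes "open U" "x \<in> U"
  shows "\<exists>W \<epsilon>. finite W \<and> \<epsilon> > 0 \<and> {q. \<forall>w\<in>W. dist (x w) (q w) < \<epsilon>} \<subseteq> U"
proof -
  have "openin (product_topology (\<lambda>_. euclidean) UNIV) U"
    using assms(1) by (simp add: euclidean_product_topology)
  from product_topology_open_contains_basis[OF this assms(2)]
  obtain V where V: "x \<in> PiE UNIV V" "\<And>i. openin euclidean (V i)" "finite {i. V i \<noteq> topspace euclidean}"
      "PiE UNIV V \<subseteq> U"
    by blast
  define W where "W = {i. V i \<noteq> UNIV}"
  have "finite W" using V(3) by (simp add: W_def)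
  have "\<exists>e>0. ball (x i) e \<subseteq> V i" for i
    using V(1,2) by (auto simp: open_contains_ball PiE_iff)
  then obtain e where e: "\<And>i. e i > 0" "\<And>i. ball (x i) (e i) \<subseteq> V i" by metis
  define \<epsilon> where "\<epsilon> = Min (insert 1 (e ` W))"
  have "\<epsilon> > 0" using e(1) \<open>finite W\<close> by (simp add: \<epsilon>_def)
  moreover have "{q. \<forall>w\<in>W. dist (x w) (q w) < \<epsilon>} \<subseteq> U"
  proof
    fix q assume q: "q \<in> {q. \<forall>w\<in>W. dist (x w) (q w) < \<epsilon>}"
    have "q i \<in> V i" for i
    proof (cases "i \<in> W")
      case True
      then have "\<epsilon> \<le> e i" using \<open>finite W\<close> by (simp add: \<epsilon>_def)
      with True q have "q i \<in> ball (x i) (e i)" by force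
      then show ?thesis using e(2) by blast
    qed (simp add: W_def)
    then show "q \<in> U" using V(4) by (auto simp: PiE_iff)
  qed
  ultimately show ?thesis using \<open>finite W\<close> by blast
qed

text \<open>A Lebesgue number argument: each point has a cylinder of small
  \<open>\<rho>\<close>-radius, and compactness makes the window \<open>W\<close> and the tolerance
  uniform.\<close>

lemma metric_small_on_cylinders:
  fixes X :: "('g \<Rightarrow> 'a::metric_space) set"
  assumes "compact X" and metric: "Metric_space X \<rho>"
    and topology: "Metric_space.mtopology X \<rho> = subtopology euclidean X" and "\<delta> > 0"
  obtains W \<epsilon> where "finite W" "\<epsilon> > 0"
    "\<And>p q. p \<in> X \<Longrightarrow> q \<in> X \<Longrightarrow> (\<And>w. w \<in> W \<Longrightarrow> dist (p w) (q w) < \<epsilon>) \<Longrightarrow> \<rho> p q < \<delta>"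
proof -
  interpret Metric_space X \<rho> by (rule metric)
  define good where "good x W \<epsilon> \<longleftrightarrow> finite W \<and> \<epsilon> > 0 \<and>
    (\<forall>q\<in>X. (\<forall>w\<in>W. dist (x w) (q w) < \<epsilon>) \<longrightarrow> \<rho> x q < \<delta> / 2)" for x :: "'g \<Rightarrow> 'a" and W \<epsilon>
  have "\<exists>W \<epsilon>. good x W \<epsilon>" if "x \<in> X" for x
  proof -
    have "openin (subtopology euclidean X) (mball x (\<delta> / 2))"
      using openin_mball[of x "\<delta> / 2"] by (simp only: topology)
    then obtain U where U: "open U" "mball x (\<delta> / 2) = U \<inter> X" by (auto simp: openin_subtopology)
    have "x \<in> mball x (\<delta> / 2)" using that \<open>\<delta> > 0\<close> by simp
    then have "x \<in> U" using U(2) by blast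
    from open_fun_contains_cylinder[OF U(1) this] obtain W \<epsilon>
      where W: "finite W" "\<epsilon> > 0" "{q. \<forall>w\<in>W. dist (x w) (q w) < \<epsilon>} \<subseteq> U" by blast
    have "\<rho> x q < \<delta> / 2" if "q \<in> X" "\<forall>w\<in>W. dist (x w) (q w) < \<epsilon>" for q
    proof -
      have "q \<in> mball x (\<delta> / 2)" unfolding U(2) using that W(3) by blast
      then show ?thesis by simp
    qed
    with W(1,2) show ?thesis unfolding good_def by blast
  qed
  then obtain W \<epsilon> where good: "\<And>x. x \<in> X \<Longrightarrow> good x (W x) (\<epsilon> x)" by metis
  have W: "\<And>x. x \<in> X \<Longrightarrow> finite (W x)" "\<And>x. x \<in> X \<Longrightarrow> \<epsilon> x > 0"
    "\<And>x q. x \<in> X \<Longrightarrow> q \<in> X \<Longrightarrow> (\<And>w. w \<in> W x \<Longrightarrow> dist (x w) (q w) < \<epsilon> x) \<Longrightarrow> \<rho> x q < \<delta> / 2"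
    using good unfolding good_def by blast+
  \<comment> \<open>Half the radius, so that a point \<open>q\<close> close to \<open>p\<close>
    still lies in the full cylinder around the same centre \<open>x\<close>.\<close>
  define B where "B x = {q. \<forall>w\<in>W x. dist (x w) (q w) < \<epsilon> x / 2}" for x
  have "open (B x)" if "x \<in> X" for x
  proof -
    have "B x = (\<Inter>w\<in>W x. {q. dist (x w) (q w) < \<epsilon> x / 2})" by (auto simp: B_def)
    then show ?thesis using W(1)[OF that] by (auto intro!: open_INT open_Collect_less continuous_intros)
  qed
  moreover have "X \<subseteq> (\<Union>x\<in>X. B x)" using W(2) by (force simp: B_def)
  ultimately obtain C where C: "C \<subseteq> X" "finite C" "X \<subseteq> (\<Union>x\<in>C. B x)"
    using compactE_image[OF \<open>compact X\<close>, of X B] by metis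
  define \<eta> where "\<eta> = Min (insert 1 ((\<lambda>x. \<epsilon> x / 2) ` C))"
  show ?thesis
  proof (rule that[of "\<Union>x\<in>C. W x" \<eta>])
    show "finite (\<Union>x\<in>C. W x)" using C W(1) by blast
    show "\<eta> > 0" using C W(2) by (auto simp: \<eta>_def)
    fix p q assume pq: "p \<in> X" "q \<in> X" "\<And>w. w \<in> (\<Union>x\<in>C. W x) \<Longrightarrow> dist (p w) (q w) < \<eta>"
    then obtain x where x: "x \<in> C" "p \<in> B x" using C(3) by blast
    have "x \<in> X" using x(1) C(1) by blast
    have "\<eta> \<le> \<epsilon> x / 2" unfolding \<eta>_def using C(2) x(1) by (intro Min_le) auto
    have near_p: "dist (x w) (p w) < \<epsilon> x / 2" if "w \<in> W x" for w using that x(2) by (auto simp: B_def)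
    have "\<rho> x p < \<delta> / 2"
      using near_p W(2)[OF \<open>x \<in> X\<close>] by (intro W(3) \<open>x \<in> X\<close> pq) force
    moreover have "\<rho> x q < \<delta> / 2"
    proof (intro W(3) \<open>x \<in> X\<close> pq)
      fix w assume w: "w \<in> W x"
      have "dist (p w) (q w) < \<eta>" using pq(3) x(1) w by blast
      then show "dist (x w) (q w) < \<epsilon> x"
        using dist_triangle[of "x w" "q w" "p w"] near_p[OF w] \<open>\<eta> \<le> \<epsilon> x / 2\<close> by linarith
    qed
    ultimately show "\<rho> p q < \<delta>"
      using triangle[of p x q] commute[of p x] \<open>x \<in> X\<close> pq by simp
  qed
qed

text \<open>Since \<open>Y\<close> lies in \<open>X\<close>, the first of the two suprema is zero
  and only the density of \<open>Y\<close> counts.\<close>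

lemma hausdorff_dist_dense_subset:
  assumes "Metric_space X \<rho>" "Y \<subseteq> X" "Y \<noteq> {}"
    and dense: "\<And>z. z \<in> X \<Longrightarrow> \<exists>y\<in>Y. \<rho> z y < \<delta>"
  shows "0 \<le> hausdorff_dist \<rho> Y X" "hausdorff_dist \<rho> Y X \<le> \<delta>"
proof -
  interpret Metric_space X \<rho> by (rule assms(1))
  have "X \<noteq> {}" using assms by blast
  have bdd: "bdd_below (\<rho> z ` A)" for z A by (rule bdd_belowI[of _ 0]) auto
  have zero: "(INF z\<in>X. \<rho> y z) = 0" if "y \<in> Y" for y
  proof (rule antisym)
    have "y \<in> X" using that assms by blast
    then show "(INF z\<in>X. \<rho> y z) \<le> 0"
      using cINF_lower[OF bdd, of y X y] by simp
    show "0 \<le> (INF z\<in>X. \<rho> y z)" using \<open>X \<noteq> {}\<close> by (intro cINF_greatest) auto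
  qed
  have nonneg: "0 \<le> (INF y\<in>Y. \<rho> z y)" for z using assms(3) by (intro cINF_greatest) auto
  have le: "(INF y\<in>Y. \<rho> z y) \<le> \<delta>" if z: "z \<in> X" for z
  proof -
    obtain y where y: "y \<in> Y" "\<rho> z y < \<delta>" using dense[OF z] by blast
    have "(INF y\<in>Y. \<rho> z y) \<le> \<rho> z y"
      by (rule cINF_lower[OF bdd y(1)])
    with y(2) show ?thesis by simp
  qed
  obtain z where "z \<in> X" using \<open>X \<noteq> {}\<close> by blast
  have "0 \<le> (SUP z\<in>X. INF y\<in>Y. \<rho> z y)"
    using nonneg[of z] le by (intro cSUP_upper2[OF _ \<open>z \<in> X\<close>]) (auto simp: bdd_above_def)
  moreover have "(SUP z\<in>X. INF y\<in>Y. \<rho> z y) \<le> \<delta>" using \<open>X \<noteq> {}\<close> le by (rule cSUP_least)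
  moreover have "(SUP y\<in>Y. INF z\<in>X. \<rho> y z) = 0" using assms(3) zero by simp
  ultimately show "0 \<le> hausdorff_dist \<rho> Y X" "hausdorff_dist \<rho> Y X \<le> \<delta>"
    by (auto simp: hausdorff_dist_def)
qed

section \<open>Density of periodic points\<close>

lemma periodic_points_dense_on_cylinders:
  fixes \<Gamma>n :: "nat \<Rightarrow> 'g::group_add set" and f :: "'g \<Rightarrow> int"
  assumes subgroups: "\<forall>n\<ge>1. is_normal_subgroup (\<Gamma>n n) \<and> finite_index (\<Gamma>n n)"
    and inter: "(\<Inter>n\<in>{1..}. \<Union>i\<in>{n..}. \<Gamma>n i) = {0}"
    and wb: "well_balanced f" and "finite W" "\<epsilon> > 0"
  obtains n0 where "\<And>n p. n \<ge> n0 \<Longrightarrow> p \<in> X_f f \<Longrightarrow> \<exists>y\<in>Fix (\<Gamma>n n) (X_f f). \<forall>w\<in>W. dist (p w) (y w) < \<epsilon>"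
proof -
  interpret balanced f by unfold_locales (rule wb)
  obtain N :: nat where N:
    "\<And>(Y :: ('g \<Rightarrow> complex) set) p.
      (\<lambda>_. 1) \<in> Y \<Longrightarrow>
      (\<And>y z. y \<in> Y \<Longrightarrow> z \<in> Y \<Longrightarrow> (\<lambda>t. y t * z t) \<in> Y) \<Longrightarrow>
      (\<And>y. y \<in> Y \<Longrightarrow> (\<lambda>t. inverse (y t)) \<in> Y) \<Longrightarrow>
      (\<And>y t. y \<in> Y \<Longrightarrow> norm (y t) = 1) \<Longrightarrow>
      (\<And>t. norm (p t) = 1) \<Longrightarrow>
      (\<And>h. (\<And>w. \<bar>h w\<bar> \<le> int N) \<Longrightarrow> (\<And>y. y \<in> Y \<Longrightarrow> (\<Prod>w\<in>W. y w powi h w) = 1) \<Longrightarrow>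
        (\<Prod>w\<in>W. p w powi h w) = 1) \<Longrightarrow>
      \<exists>y\<in>Y. \<forall>w\<in>W. dist (p w) (y w) < \<epsilon>"
    using uniform_torus_duality[OF assms(4,5)] by blast
  \<comment> \<open>Only finitely many exponent vectors on \<open>W\<close> have to be tested,
    independently of \<open>n\<close>; each has its own finite set \<open>F h\<close> to be
    avoided.\<close>
  define \<H> where "\<H> = PiE W (\<lambda>_. {- int N..int N})"
  have "finite \<H>" using assms(4) by (simp add: \<H>_def finite_PiE)
  define good where "good h F \<longleftrightarrow> finite F \<and> (\<forall>H x. is_normal_subgroup H \<longrightarrow> finite_index H \<longrightarrow> H \<inter> F \<subseteq> {0} \<longrightarrow>
      (\<forall>x. periodic H x \<longrightarrow> (\<forall>t. L x t \<in> \<int>) \<longrightarrow> (\<Sum>k\<in>W. of_int (h k) * x k) \<in> \<int>) \<longrightarrow>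
      (\<forall>t. L x t \<in> \<int>) \<longrightarrow> (\<Sum>k\<in>W. of_int (h k) * x k) \<in> \<int>)" for h F
  have "\<exists>F. good h F" for h
    unfolding good_def by (rule periodic_annihilator_annihilates[OF assms(4), of h]) blast
  then obtain F where "\<And>h. good h (F h)" by metis
  then have F: "\<And>h. finite (F h)"
    "\<And>h H x. is_normal_subgroup H \<Longrightarrow> finite_index H \<Longrightarrow> H \<inter> F h \<subseteq> {0} \<Longrightarrow>
      (\<And>x. periodic H x \<Longrightarrow> (\<And>t. L x t \<in> \<int>) \<Longrightarrow> (\<Sum>k\<in>W. of_int (h k) * x k) \<in> \<int>) \<Longrightarrow>
      (\<And>t. L x t \<in> \<int>) \<Longrightarrow> (\<Sum>k\<in>W. of_int (h k) * x k) \<in> \<int>"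
    unfolding good_def by blast+
  \<comment> \<open>\<open>0\<close> is removed because it lies in every subgroup; each other
    element eventually leaves all \<open>\<Gamma>n i\<close> by the intersection hypothesis.\<close>
  define G where "G = (\<Union>h\<in>\<H>. F h) - {0}"
  have "finite G" using \<open>finite \<H>\<close> F(1) by (simp add: G_def)
  have "\<exists>n. \<forall>i\<ge>n. g \<notin> \<Gamma>n i" if "g \<in> G" for g
  proof -
    have "g \<notin> (\<Inter>n\<in>{1..}. \<Union>i\<in>{n..}. \<Gamma>n i)" using that inter by (simp add: G_def)
    then show ?thesis by auto
  qed
  then obtain m where m: "\<And>g i. g \<in> G \<Longrightarrow> i \<ge> m g \<Longrightarrow> g \<notin> \<Gamma>n i" by metis
  show ?thesis
  proof (rule that[of "Max (insert 1 (m ` G))"])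
    fix n p assume n: "n \<ge> Max (insert 1 (m ` G))" and "p \<in> X_f f"
    have "n \<ge> 1" "\<And>g. g \<in> G \<Longrightarrow> n \<ge> m g" using n \<open>finite G\<close> by auto
    then have H: "is_normal_subgroup (\<Gamma>n n)" "finite_index (\<Gamma>n n)" "\<Gamma>n n \<inter> G = {}"
      using subgroups m by auto
    obtain x where x: "p = (\<lambda>t. circ (x t))" "\<And>t. L x t \<in> \<int>"
      using \<open>p \<in> X_f f\<close> by (auto simp: X_f_def laplace_def)
    show "\<exists>y\<in>Fix (\<Gamma>n n) (X_f f). \<forall>w\<in>W. dist (p w) (y w) < \<epsilon>"
    proof (rule N)
      show "norm (y t) = 1" if "y \<in> Fix (\<Gamma>n n) (X_f f)" for y t
        using that by (simp add: Fix_def X_f_iff)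
      show "norm (p t) = 1" for t using \<open>p \<in> X_f f\<close> by (simp add: X_f_iff)
      fix h :: "'g \<Rightarrow> int"
      assume h: "\<And>w. \<bar>h w\<bar> \<le> int N"
        and triv: "\<And>y. y \<in> Fix (\<Gamma>n n) (X_f f) \<Longrightarrow> (\<Prod>w\<in>W. y w powi h w) = 1"
      \<comment> \<open>Restriction makes \<open>h\<close> extensional and so a member of the finite
        set \<open>\<H>\<close>, without changing sums over \<open>W\<close>.\<close>
      define h' where "h' = restrict h W"
      have "h' \<in> \<H>" using h by (auto simp: h'_def \<H>_def abs_le_iff minus_le_iff)
      then have "\<Gamma>n n \<inter> F h' \<subseteq> {0}" using H(3) by (auto simp: G_def)
      have eq: "(\<Sum>w\<in>W. of_int (h' w) * z w) = (\<Sum>w\<in>W. of_int (h w) * z w)" for z :: "'g \<Rightarrow> real"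
        by (simp add: h'_def)
      have "(\<Sum>w\<in>W. of_int (h' w) * x w) \<in> \<int>"
      proof (rule F(2)[OF H(1,2) \<open>\<Gamma>n n \<inter> F h' \<subseteq> {0}\<close> _ x(2)])
        fix z assume "periodic (\<Gamma>n n) z" "\<And>t. L z t \<in> \<int>"
        then have "(\<Prod>w\<in>W. circ (z w) powi h w) = 1"
          using triv[OF circ_periodic_in_Fix[OF H(1)]] by simp
        then show "(\<Sum>w\<in>W. of_int (h' w) * z w) \<in> \<int>" by (simp add: eq prod_circ_powi circ_eq_1_iff)
      qed
      then show "(\<Prod>w\<in>W. p w powi h w) = 1" by (simp add: x(1) eq prod_circ_powi circ_eq_1_iff)
    qed (auto intro: one_in_Fix mult_in_Fix inverse_in_Fix)
  qed
qed

theorem theorem5p1: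
  fixes \<Gamma>n :: "nat \<Rightarrow> 'g::group_add set"
    and f :: "'g \<Rightarrow> int"
    and \<rho> :: "('g \<Rightarrow> complex) \<Rightarrow> ('g \<Rightarrow> complex) \<Rightarrow> real"
  assumes "finitely_generated TYPE('g)"
    and "residually_finite TYPE('g)"
    and "infinite (UNIV :: 'g set)"
    and "\<forall>n\<ge>1. is_normal_subgroup (\<Gamma>n n) \<and> finite_index (\<Gamma>n n)"
    and "(\<Inter>n\<in>{1..}. \<Union>i\<in>{n..}. \<Gamma>n i) = {0}"
    and "well_balanced f"
    and "Metric_space (X_f f) \<rho>"
    and "Metric_space.mtopology (X_f f) \<rho> = subtopology euclidean (X_f f)"
  shows "(\<lambda>n. hausdorff_dist \<rho> (Fix (\<Gamma>n n) (X_f f)) (X_f f)) \<longlonglongrightarrow> 0"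
proof (rule LIMSEQ_I)
  fix r :: real assume "r > 0"
  \<comment> \<open>Half of \<open>r\<close>, because the bound on the Hausdorff distance is not
    strict.\<close>
  then have "r / 2 > 0" by simp
  from metric_small_on_cylinders[OF compact_X_f assms(7,8) this]
  obtain W \<epsilon> where W: "finite W" "\<epsilon> > 0"
    "\<And>p q. p \<in> X_f f \<Longrightarrow> q \<in> X_f f \<Longrightarrow> (\<And>w. w \<in> W \<Longrightarrow> dist (p w) (q w) < \<epsilon>) \<Longrightarrow> \<rho> p q < r / 2"
    by blast
  obtain n0 where n0: "\<And>n p. n \<ge> n0 \<Longrightarrow> p \<in> X_f f \<Longrightarrow>
      \<exists>y\<in>Fix (\<Gamma>n n) (X_f f). \<forall>w\<in>W. dist (p w) (y w) < \<epsilon>"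
    using periodic_points_dense_on_cylinders[OF assms(4-6) W(1,2)] by blast
  have sub: "Fix (\<Gamma>n n) (X_f f) \<subseteq> X_f f" for n by (auto simp: Fix_def)
  have "\<bar>hausdorff_dist \<rho> (Fix (\<Gamma>n n) (X_f f)) (X_f f)\<bar> \<le> r / 2" if "n \<ge> n0" for n
  proof -
    have ne: "Fix (\<Gamma>n n) (X_f f) \<noteq> {}" using one_in_Fix by blast
    have "\<exists>y\<in>Fix (\<Gamma>n n) (X_f f). \<rho> z y < r / 2" if "z \<in> X_f f" for z
      using n0[OF \<open>n \<ge> n0\<close> that] W(3)[OF that] sub by blast
    from hausdorff_dist_dense_subset[OF assms(7) sub ne this] show ?thesis by simp
  qed
  then show "\<exists>n0. \<forall>n\<ge>n0. norm (hausdorff_dist \<rho> (Fix (\<Gamma>n n) (X_f f)) (X_f f) - 0) < r"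
    using \<open>r > 0\<close> by (intro exI[of _ n0]) force
qed

end
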